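(* Let $\mathcal{C}$ be a regular protomodular category with a fixed class $\mathcal{Z}$ of zero objects. There is a one-to-one correspondence (given by sending a torsion theory $(\mathcal{T},\mathcal{F})$ to its torsion-free part $\mathcal{F}$) between $\mathcal{Z}$-torsion theories in $\mathcal{C}$ satisfying Conditions (M') and (S), and full, replete, reflective subcategories $\mathcal{F}\subseteq\mathcal{C}$ with reflector $\mathsf{F}\colon\mathcal{C}\to\mathcal{F}$ and unit $\eta$ such that every component $\eta_A$ is a $\mathcal{Z}$-cokernel, $\mathsf{F}(Z)=Z$ for every $Z\in\mathcal{Z}$ (i.e. $\eta_Z$ is an isomorphism), and the reflector $\mathsf{F}$ is semi-left exact.
   Context: A category is protomodular if it has pullbacks of split epimorphisms along any arrow and, whenever a split epimorphism $p\colon C\to B$ with section $s$ is pulled back along $f\colon A\to B$, giving $g\colon A\times_B C\to C$, the pair $(g,s)$ is jointly extremally epimorphic. A class of zero objects in a category $\mathcal{C}$ is a full subcategory $\mathcal{Z}$ (taken closed under isomorphism) which is posetal (at most one morphism between any two of its objects), monocoreflective (the inclusion has a right adjoint $\mathsf{Z}$, the coreflector, with every counit component $\varepsilon_A\colon\mathsf{Z}(A)\to A$ a monomorphism), and such that $\mathsf{Z}(m)$ is an isomorphism for every monomorphism $m$ of $\mathcal{C}$. $\mathcal{N}_{\mathcal{Z}}$ denotes the class of arrows of $\mathcal{C}$ factoring through an object of $\mathcal{Z}$. A $\mathcal{Z}$-kernel of $f\colon A\to B$ is an arrow $k\colon K\to A$ with $fk\in\mathcal{N}_{\mathcal{Z}}$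 such that every $e\colon E\to A$ with $fe\in\mathcal{N}_{\mathcal{Z}}$ factors uniquely through $k$; $\mathcal{Z}$-cokernels are defined dually; an arrow "is a $\mathcal{Z}$-cokernel" if it is one of some arrow. A sequence $A\xrightarrow{f}B\xrightarrow{g}C$ is short $\mathcal{Z}$-exact if $f$ is a $\mathcal{Z}$-kernel of $g$ and $g$ is a $\mathcal{Z}$-cokernel of $f$. A $\mathcal{Z}$-torsion theory is a pair $(\mathcal{T},\mathcal{F})$ of full replete subcategories of $\mathcal{C}$ such that: $\mathcal{T}\cap\mathcal{F}=\mathcal{Z}$; every arrow $T\to F$ with $T\in\mathcal{T}$, $F\in\mathcal{F}$ lies in $\mathcal{N}_{\mathcal{Z}}$; for every $A\in\mathcal{C}$ there is a short $\mathcal{Z}$-exact sequence $\mathsf{T}(A)\xrightarrow{t_A}A\xrightarrow{\eta_A}\mathsf{F}(A)$ with $\mathsf{T}(A)\in\mathcal{T}$, $\mathsf{F}(A)\in\mathcal{F}$ (unique up to isomorphism). The assignment $\mathsf{F}$ extends to a functor $\mathcal{C}\to\mathcal{F}$ left adjoint to the inclusion, with unit $\eta$. If $T\in\mathcal{T}$ then $\mathsf{F}(T)\in\mathcal{Z}$. Condition (M'): for every object $A$ of $\mathcal{C}$, $\mathsf{F}(\mathsf{T}(A))\cong\mathsf{Z}(\mathsf{F}(A))$. Condition (S): for every $T\in\mathcal{T}$, with $\eta_T\colon T\to Z$, $Z=\mathsf{F}(T)\in\mathcal{Z}$, and every arrow $Z'\to Z$ with $Z'\in\mathcal{Z}$,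 the pullback $\chi\colon T'\to Z'$ of $\eta_T$ along $Z'\to Z$ satisfies $T'\in\mathcal{T}$ and $\chi=\eta_{T'}$ (up to isomorphism). A reflector $\mathsf{F}\colon\mathcal{C}\to\mathcal{F}$ with unit $\eta$ is semi-left exact if for every object $X$ of $\mathcal{C}$ and every arrow $f\colon F\to\mathsf{F}(X)$ of $\mathcal{F}$, $\mathsf{F}(f^*(\eta_X))$ is an isomorphism, where $f^*(\eta_X)$ is the pullback of $\eta_X$ along $f$. *)

theory Defs
  imports Main
begin

section \<open>Categories\<close>

text \<open>Composition is in applicative order: \<open>g \<cdot> f\<close> is ``first \<open>f\<close>, then \<open>g\<close>''. Nothing is
  required of the operations outside the carriers \<open>Obj\<close> and \<open>Arr\<close>.\<close>

record ('o, 'm) cat =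
  Obj :: "'o set"
  Arr :: "'m set"
  Dom :: "'m \<Rightarrow> 'o"
  Cod :: "'m \<Rightarrow> 'o"
  idt :: "'o \<Rightarrow> 'm"
  Comp :: "'m \<Rightarrow> 'm \<Rightarrow> 'm"  (infixl "\<cdot>\<index>" 70)

definition Hom :: "('o, 'm, 'x) cat_scheme \<Rightarrow> 'o \<Rightarrow> 'o \<Rightarrow> 'm set" where
  "Hom C A B = {f \<in> Arr C. Dom C f = A \<and> Cod C f = B}"

locale category =
  fixes C :: "('o, 'm, 'x) cat_scheme" (structure)
  assumes dom_in_Obj: "f \<in> Arr C \<Longrightarrow> Dom C f \<in> Obj C"
    and cod_in_Obj: "f \<in> Arr C \<Longrightarrow> Cod C f \<in> Obj C"
    and idt_in_hom: "A \<in> Obj C \<Longrightarrow> idt C A \<in> Hom C A A"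
    and comp_in_hom: "f \<in> Hom C A B \<Longrightarrow> g \<in> Hom C B D \<Longrightarrow> g \<cdot> f \<in> Hom C A D"
    and comp_idt_right: "f \<in> Arr C \<Longrightarrow> f \<cdot> idt C (Dom C f) = f"
    and comp_idt_left: "f \<in> Arr C \<Longrightarrow> idt C (Cod C f) \<cdot> f = f"
    and comp_assoc: "f \<in> Hom C A B \<Longrightarrow> g \<in> Hom C B D \<Longrightarrow> h \<in> Hom C D E \<Longrightarrow>
      h \<cdot> (g \<cdot> f) = (h \<cdot> g) \<cdot> f"

definition is_iso :: "('o, 'm, 'x) cat_scheme \<Rightarrow> 'm \<Rightarrow> bool" where
  "is_iso C f \<longleftrightarrow> f \<in> Arr C \<and>
     (\<exists>g \<in> Hom C (Cod C f) (Dom C f).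
        Comp C g f = idt C (Dom C f) \<and> Comp C f g = idt C (Cod C f))"

definition iso_objects :: "('o, 'm, 'x) cat_scheme \<Rightarrow> 'o \<Rightarrow> 'o \<Rightarrow> bool" where
  "iso_objects C A B \<longleftrightarrow> (\<exists>f \<in> Hom C A B. is_iso C f)"

definition monic :: "('o, 'm, 'x) cat_scheme \<Rightarrow> 'm \<Rightarrow> bool" where
  "monic C m \<longleftrightarrow> m \<in> Arr C \<and>
     (\<forall>A \<in> Obj C. \<forall>f \<in> Hom C A (Dom C m). \<forall>g \<in> Hom C A (Dom C m).
        Comp C m f = Comp C m g \<longrightarrow> f = g)"

section \<open>Limits, regularity, protomodularity\<close>

definition terminal :: "('o, 'm, 'x) cat_scheme \<Rightarrow> 'o \<Rightarrow> bool" where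
  "terminal C T \<longleftrightarrow> T \<in> Obj C \<and> (\<forall>A \<in> Obj C. \<exists>!f. f \<in> Hom C A T)"

text \<open>\<open>is_pullback C f g p q\<close>: the square \<open>f \<cdot> p = g \<cdot> q\<close> is a pullback. Thus \<open>q\<close> is the pullback
  of \<open>f\<close> along \<open>g\<close>, and \<open>p\<close> is the pullback of \<open>g\<close> along \<open>f\<close>.\<close>

definition is_pullback :: "('o, 'm, 'x) cat_scheme \<Rightarrow> 'm \<Rightarrow> 'm \<Rightarrow> 'm \<Rightarrow> 'm \<Rightarrow> bool" where
  "is_pullback C f g p q \<longleftrightarrow>
     f \<in> Arr C \<and> g \<in> Arr C \<and> p \<in> Arr C \<and> q \<in> Arr C \<and>
     Cod C f = Cod C g \<and> Dom C p = Dom C q \<and> Cod C p = Dom C f \<and> Cod C q = Dom C g \<and>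
     Comp C f p = Comp C g q \<and>
     (\<forall>X \<in> Obj C. \<forall>a \<in> Hom C X (Dom C f). \<forall>b \<in> Hom C X (Dom C g).
        Comp C f a = Comp C g b \<longrightarrow>
        (\<exists>!u. u \<in> Hom C X (Dom C p) \<and> Comp C p u = a \<and> Comp C q u = b))"

definition is_coequalizer :: "('o, 'm, 'x) cat_scheme \<Rightarrow> 'm \<Rightarrow> 'm \<Rightarrow> 'm \<Rightarrow> bool" where
  "is_coequalizer C f g e \<longleftrightarrow>
     f \<in> Arr C \<and> g \<in> Arr C \<and> e \<in> Arr C \<and>
     Dom C f = Dom C g \<and> Cod C f = Cod C g \<and> Dom C e = Cod C f \<and>
     Comp C e f = Comp C e g \<and>
     (\<forall>X \<in> Obj C. \<forall>h \<in> Hom C (Cod C f) X. Comp C h f = Comp C h g \<longrightarrow>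
        (\<exists>!u. u \<in> Hom C (Cod C e) X \<and> Comp C u e = h))"

definition regular_epi :: "('o, 'm, 'x) cat_scheme \<Rightarrow> 'm \<Rightarrow> bool" where
  "regular_epi C e \<longleftrightarrow> (\<exists>f g. is_coequalizer C f g e)"

text \<open>Finite completeness is given by a terminal object and pullbacks; a pullback of \<open>f\<close> along
  itself is a kernel pair of \<open>f\<close>.\<close>

locale regular_category = category C
  for C :: "('o, 'm, 'x) cat_scheme" (structure) +
  assumes has_terminal: "\<exists>T. terminal C T"
    and has_pullbacks: "f \<in> Arr C \<Longrightarrow> g \<in> Arr C \<Longrightarrow> Cod C f = Cod C g \<Longrightarrow>
      \<exists>p q. is_pullback C f g p q"
    and kernel_pair_coequalizer: "is_pullback C f f p q \<Longrightarrow> \<exists>e. is_coequalizer C p q e"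
    and regular_epi_stable: "is_pullback C f g p q \<Longrightarrow> regular_epi C f \<Longrightarrow> regular_epi C q"

definition jointly_extremally_epi :: "('o, 'm, 'x) cat_scheme \<Rightarrow> 'm \<Rightarrow> 'm \<Rightarrow> bool" where
  "jointly_extremally_epi C f g \<longleftrightarrow>
     f \<in> Arr C \<and> g \<in> Arr C \<and> Cod C f = Cod C g \<and>
     (\<forall>m. monic C m \<longrightarrow> Cod C m = Cod C f \<longrightarrow>
        (\<exists>f' \<in> Hom C (Dom C f) (Dom C m). Comp C m f' = f) \<longrightarrow>
        (\<exists>g' \<in> Hom C (Dom C g) (Dom C m). Comp C m g' = g) \<longrightarrow> is_iso C m)"

definition split_epi_with_section :: "('o, 'm, 'x) cat_scheme \<Rightarrow> 'm \<Rightarrow> 'm \<Rightarrow> bool" where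
  "split_epi_with_section C p s \<longleftrightarrow>
     p \<in> Arr C \<and> s \<in> Hom C (Cod C p) (Dom C p) \<and> Comp C p s = idt C (Cod C p)"

locale protomodular_category = category C
  for C :: "('o, 'm, 'x) cat_scheme" (structure) +
  assumes has_split_epi_pullbacks:
      "split_epi_with_section C p s \<Longrightarrow> f \<in> Arr C \<Longrightarrow> Cod C f = Cod C p \<Longrightarrow>
        \<exists>g q. is_pullback C p f g q"
    and protomodular:
      "split_epi_with_section C p s \<Longrightarrow> is_pullback C p f g q \<Longrightarrow> jointly_extremally_epi C g s"

section \<open>Reflections and coreflections\<close>

text \<open>A full subcategory is represented by its set of objects.\<close>

definition full_replete :: "('o, 'm, 'x) cat_scheme \<Rightarrow> 'o set \<Rightarrow> bool" where
  "full_replete C S \<longleftrightarrow> S \<subseteq> Obj C \<and> (\<forall>A \<in> S. \<forall>B \<in> Obj C. iso_objects C A B \<longrightarrow> B \<in> S)"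

text \<open>\<open>Fo\<close> and \<open>Fm\<close> are the object and arrow parts of a functor from \<open>C\<close> to the full subcategory
  on \<open>S\<close>.\<close>

definition functor_into ::
  "('o, 'm, 'x) cat_scheme \<Rightarrow> 'o set \<Rightarrow> ('o \<Rightarrow> 'o) \<Rightarrow> ('m \<Rightarrow> 'm) \<Rightarrow> bool" where
  "functor_into C S Fo Fm \<longleftrightarrow>
     (\<forall>A \<in> Obj C. Fo A \<in> S) \<and>
     (\<forall>f \<in> Arr C. Fm f \<in> Hom C (Fo (Dom C f)) (Fo (Cod C f))) \<and>
     (\<forall>A \<in> Obj C. Fm (idt C A) = idt C (Fo A)) \<and>
     (\<forall>f \<in> Arr C. \<forall>g \<in> Arr C. Cod C f = Dom C g \<longrightarrow> Fm (Comp C g f) = Comp C (Fm g) (Fm f))"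

text \<open>The functor \<open>(Fo, Fm)\<close> is left adjoint to the inclusion of the full subcategory on \<open>S\<close>,
  with unit \<open>\<eta>\<close>.\<close>

definition reflector ::
  "('o, 'm, 'x) cat_scheme \<Rightarrow> 'o set \<Rightarrow> ('o \<Rightarrow> 'o) \<Rightarrow> ('m \<Rightarrow> 'm) \<Rightarrow> ('o \<Rightarrow> 'm) \<Rightarrow> bool" where
  "reflector C S Fo Fm \<eta> \<longleftrightarrow>
     functor_into C S Fo Fm \<and>
     (\<forall>A \<in> Obj C. \<eta> A \<in> Hom C A (Fo A)) \<and>
     (\<forall>f \<in> Arr C. Comp C (\<eta> (Cod C f)) f = Comp C (Fm f) (\<eta> (Dom C f))) \<and>
     (\<forall>A \<in> Obj C. \<forall>B \<in> S. \<forall>g \<in> Hom C A B. \<exists>!h. h \<in> Hom C (Fo A) B \<and> Comp C h (\<eta> A) = g)"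

text \<open>The functor \<open>(Zo, Zm)\<close> is right adjoint to the inclusion of the full subcategory on \<open>S\<close>,
  with counit \<open>\<epsilon>\<close>.\<close>

definition coreflector ::
  "('o, 'm, 'x) cat_scheme \<Rightarrow> 'o set \<Rightarrow> ('o \<Rightarrow> 'o) \<Rightarrow> ('m \<Rightarrow> 'm) \<Rightarrow> ('o \<Rightarrow> 'm) \<Rightarrow> bool" where
  "coreflector C S Zo Zm \<epsilon> \<longleftrightarrow>
     functor_into C S Zo Zm \<and>
     (\<forall>A \<in> Obj C. \<epsilon> A \<in> Hom C (Zo A) A) \<and>
     (\<forall>f \<in> Arr C. Comp C f (\<epsilon> (Dom C f)) = Comp C (\<epsilon> (Cod C f)) (Zm f)) \<and>
     (\<forall>A \<in> Obj C. \<forall>W \<in> S. \<forall>g \<in> Hom C W A. \<exists>!h. h \<in> Hom C W (Zo A) \<and> Comp C (\<epsilon> A) h = g)"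

definition semi_left_exact ::
  "('o, 'm, 'x) cat_scheme \<Rightarrow> 'o set \<Rightarrow> ('o \<Rightarrow> 'o) \<Rightarrow> ('m \<Rightarrow> 'm) \<Rightarrow> ('o \<Rightarrow> 'm) \<Rightarrow> bool" where
  "semi_left_exact C S Fo Fm \<eta> \<longleftrightarrow>
     (\<forall>X \<in> Obj C. \<forall>A \<in> S. \<forall>f \<in> Hom C A (Fo X). \<forall>p q.
        is_pullback C (\<eta> X) f p q \<longrightarrow> is_iso C (Fm q))"

section \<open>Classes of zero objects, exactness, torsion theories\<close>

definition class_of_zero_objects ::
  "('o, 'm, 'x) cat_scheme \<Rightarrow> 'o set \<Rightarrow> ('o \<Rightarrow> 'o) \<Rightarrow> ('m \<Rightarrow> 'm) \<Rightarrow> ('o \<Rightarrow> 'm) \<Rightarrow> bool" where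
  "class_of_zero_objects C Z Zo Zm \<epsilon> \<longleftrightarrow>
     full_replete C Z \<and>
     (\<forall>V \<in> Z. \<forall>W \<in> Z. \<forall>f \<in> Hom C V W. \<forall>g \<in> Hom C V W. f = g) \<and>
     coreflector C Z Zo Zm \<epsilon> \<and>
     (\<forall>A \<in> Obj C. monic C (\<epsilon> A)) \<and>
     (\<forall>m. monic C m \<longrightarrow> is_iso C (Zm m))"

definition null_arrows :: "('o, 'm, 'x) cat_scheme \<Rightarrow> 'o set \<Rightarrow> 'm set" where
  "null_arrows C Z =
     {f \<in> Arr C. \<exists>W \<in> Z. \<exists>a \<in> Hom C (Dom C f) W. \<exists>b \<in> Hom C W (Cod C f). f = Comp C b a}"

text \<open>\<open>Z_kernel C Z f k\<close>: \<open>k\<close> is a kernel of \<open>f\<close>. \<open>Z_cokernel C Z f c\<close>: \<open>c\<close> is a cokernel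
  of \<open>f\<close>.\<close>

definition Z_kernel :: "('o, 'm, 'x) cat_scheme \<Rightarrow> 'o set \<Rightarrow> 'm \<Rightarrow> 'm \<Rightarrow> bool" where
  "Z_kernel C Z f k \<longleftrightarrow>
     f \<in> Arr C \<and> k \<in> Arr C \<and> Cod C k = Dom C f \<and> Comp C f k \<in> null_arrows C Z \<and>
     (\<forall>e \<in> Arr C. Cod C e = Dom C f \<longrightarrow> Comp C f e \<in> null_arrows C Z \<longrightarrow>
        (\<exists>!u. u \<in> Hom C (Dom C e) (Dom C k) \<and> Comp C k u = e))"

definition Z_cokernel :: "('o, 'm, 'x) cat_scheme \<Rightarrow> 'o set \<Rightarrow> 'm \<Rightarrow> 'm \<Rightarrow> bool" where
  "Z_cokernel C Z f c \<longleftrightarrow>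
     f \<in> Arr C \<and> c \<in> Arr C \<and> Dom C c = Cod C f \<and> Comp C c f \<in> null_arrows C Z \<and>
     (\<forall>e \<in> Arr C. Dom C e = Cod C f \<longrightarrow> Comp C e f \<in> null_arrows C Z \<longrightarrow>
        (\<exists>!u. u \<in> Hom C (Cod C c) (Cod C e) \<and> Comp C u c = e))"

definition is_Z_cokernel :: "('o, 'm, 'x) cat_scheme \<Rightarrow> 'o set \<Rightarrow> 'm \<Rightarrow> bool" where
  "is_Z_cokernel C Z c \<longleftrightarrow> (\<exists>f. Z_cokernel C Z f c)"

definition short_Z_exact :: "('o, 'm, 'x) cat_scheme \<Rightarrow> 'o set \<Rightarrow> 'm \<Rightarrow> 'm \<Rightarrow> bool" where
  "short_Z_exact C Z f g \<longleftrightarrow> Z_kernel C Z g f \<and> Z_cokernel C Z f g"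

text \<open>\<open>t\<close> and \<open>e\<close> represent the canonical sequence \<open>T(A) \<rightarrow> A \<rightarrow> F(A)\<close>, so \<open>Dom C t\<close> represents
  \<open>T(A)\<close>, \<open>Cod C e\<close> represents \<open>F(A)\<close>, and \<open>e\<close> represents \<open>\<eta>\<^sub>A\<close>. In a torsion theory such a
  sequence is unique only up to isomorphism, so the conditions below quantify over all choices
  of it.\<close>

definition torsion_sequence ::
  "('o, 'm, 'x) cat_scheme \<Rightarrow> 'o set \<Rightarrow> 'o set \<Rightarrow> 'o set \<Rightarrow> 'o \<Rightarrow> 'm \<Rightarrow> 'm \<Rightarrow> bool" where
  "torsion_sequence C Z T F A t e \<longleftrightarrow>
     short_Z_exact C Z t e \<and> Dom C t \<in> T \<and> Cod C t = A \<and> Dom C e = A \<and> Cod C e \<in> F"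

definition torsion_theory ::
  "('o, 'm, 'x) cat_scheme \<Rightarrow> 'o set \<Rightarrow> 'o set \<Rightarrow> 'o set \<Rightarrow> bool" where
  "torsion_theory C Z T F \<longleftrightarrow>
     full_replete C T \<and> full_replete C F \<and> T \<inter> F = Z \<and>
     (\<forall>A \<in> T. \<forall>B \<in> F. Hom C A B \<subseteq> null_arrows C Z) \<and>
     (\<forall>A \<in> Obj C. \<exists>t e. torsion_sequence C Z T F A t e)"

definition condition_M' ::
  "('o, 'm, 'x) cat_scheme \<Rightarrow> 'o set \<Rightarrow> ('o \<Rightarrow> 'o) \<Rightarrow> 'o set \<Rightarrow> 'o set \<Rightarrow> bool" where
  "condition_M' C Z Zo T F \<longleftrightarrow>
     (\<forall>A \<in> Obj C. \<forall>t e t' e'.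
        torsion_sequence C Z T F A t e \<longrightarrow> torsion_sequence C Z T F (Dom C t) t' e' \<longrightarrow>
        iso_objects C (Cod C e') (Zo (Cod C e)))"

text \<open>In the conclusion, \<open>\<chi> = \<eta>\<^sub>T\<^sub>'\<close> up to an isomorphism \<open>i\<close> from \<open>F(T')\<close> to \<open>Z'\<close>.\<close>

definition condition_S ::
  "('o, 'm, 'x) cat_scheme \<Rightarrow> 'o set \<Rightarrow> 'o set \<Rightarrow> 'o set \<Rightarrow> bool" where
  "condition_S C Z T F \<longleftrightarrow>
     (\<forall>A \<in> T. \<forall>t e. torsion_sequence C Z T F A t e \<longrightarrow>
        (\<forall>Z' \<in> Z. \<forall>f \<in> Hom C Z' (Cod C e). \<forall>p \<chi>. is_pullback C e f p \<chi> \<longrightarrow>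
           Dom C \<chi> \<in> T \<and>
           (\<forall>t' e'. torsion_sequence C Z T F (Dom C \<chi>) t' e' \<longrightarrow>
              (\<exists>i \<in> Hom C (Cod C e') Z'. is_iso C i \<and> \<chi> = Comp C i e'))))"

end

(* A torsion-free part F is recovered as a reflective subcategory by the arrows e of the torsion
   sequences, and T is recovered from F as the class of all objects A such that every arrow from A
   to an object of F is null. Semi-left exactness says that reflections are stable under pullback
   along arrows f of F. If it holds, pulling back a reflection along the coreflection counit of its
   codomain gives the torsion part, whose reflection is then a zero object; this yields the torsion
   theory, (M') and (S).

   Conversely, (M') and (S) make reflections stable along arrows out of zero objects. For
   a general f, let w be the comparison from the reflection of the pulled back object to the
   expected one. The pullback of w along the coreflection counit is invertible; by protomodularity w
   is monic, and it is a regular epimorphism since Z-cokernels are regular epimorphisms. *)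

theory Submission
  imports Defs
begin

section \<open>Arrows\<close>

text \<open>Everything rests on one translation: an arrow into \<open>B\<close> is null exactly when
  it factors through the monic counit \<open>\<epsilon> B\<close>, so a kernel of \<open>f\<close>
  is a pullback of \<open>f\<close> along the counit of its codomain. Torsion parts thus become
  accessible to pasting and to semi-left exactness. The delicate direction starts from (M') and (S).
  (M') asserts a bare isomorphism of objects; it becomes usable because zero objects form a poset,
  so that the isomorphism has to be the canonical comparison. (S) concerns reflections of torsion
  objects only; the bridge from a general \<open>f\<close> with domain \<open>B\<close> and codomain
  \<open>F(X)\<close> is that \<open>f \<cdot> \<epsilon> B\<close> starts at a zero object and
  hence factors through the counit of \<open>F(X)\<close>. This controls the situation over the
  coreflection of \<open>B\<close> only, and protomodularity extends the control to \<open>B\<close>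
  itself, because monicity can be tested after a pullback. Torsion sequences are unique only up to
  isomorphism, so the work is done with universal arrows of single objects, and functors appear only
  at the interface.\<close>

lemma in_Hom [simp]: "f \<in> Hom C A B \<longleftrightarrow> f \<in> Arr C \<and> Dom C f = A \<and> Cod C f = B"
  by (simp add: Hom_def)

context category
begin

lemma idt_simps [simp]:
  assumes "A \<in> Obj C"
  shows "idt C A \<in> Arr C" "Dom C (idt C A) = A" "Cod C (idt C A) = A"
  using idt_in_hom[OF assms] by auto

lemma comp_simps [simp]:
  assumes "f \<in> Arr C" "g \<in> Arr C" "Cod C f = Dom C g"
  shows "g \<cdot> f \<in> Arr C" "Dom C (g \<cdot> f) = Dom C f" "Cod C (g \<cdot> f) = Cod C g"
  using comp_in_hom[of f "Dom C f" "Dom C g" g "Cod C g"] assms by auto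

lemma assoc:
  assumes "f \<in> Arr C" "g \<in> Arr C" "h \<in> Arr C" "Cod C f = Dom C g" "Cod C g = Dom C h"
  shows "(h \<cdot> g) \<cdot> f = h \<cdot> (g \<cdot> f)"
  using comp_assoc[of f "Dom C f" "Dom C g" g "Dom C h" h "Cod C h"] assms by auto

lemma comp_idt [simp]:
  assumes "f \<in> Arr C"
  shows "Dom C f = A \<Longrightarrow> f \<cdot> idt C A = f" "Cod C f = A \<Longrightarrow> idt C A \<cdot> f = f"
  using comp_idt_right comp_idt_left assms by auto

lemma dom_cod_Obj [simp]:
  assumes "f \<in> Arr C"
  shows "Dom C f \<in> Obj C" "Cod C f \<in> Obj C"
  using dom_in_Obj cod_in_Obj assms by auto

lemma monicD:
  assumes "monic C m" "f \<in> Arr C" "g \<in> Arr C" "Cod C f = Dom C m" "Cod C g = Dom C m"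
    "Dom C f = Dom C g" "m \<cdot> f = m \<cdot> g"
  shows "f = g"
  using assms unfolding monic_def by (metis in_Hom dom_in_Obj)

lemma monicI:
  assumes "m \<in> Arr C"
    and "\<And>f g. \<lbrakk>f \<in> Arr C; g \<in> Arr C; Cod C f = Dom C m; Cod C g = Dom C m;
      Dom C f = Dom C g; m \<cdot> f = m \<cdot> g\<rbrakk> \<Longrightarrow> f = g"
  shows "monic C m"
  using assms unfolding monic_def by auto

lemma monic_Arr: "monic C m \<Longrightarrow> m \<in> Arr C"
  by (simp add: monic_def)

lemma is_isoI:
  assumes "f \<in> Arr C" "g \<in> Arr C" "Dom C g = Cod C f" "Cod C g = Dom C f"
    "g \<cdot> f = idt C (Dom C f)" "f \<cdot> g = idt C (Cod C f)"
  shows "is_iso C f"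
  using assms unfolding is_iso_def by auto

lemma is_isoE:
  assumes "is_iso C f"
  obtains g where "f \<in> Arr C" "g \<in> Arr C" "Dom C g = Cod C f" "Cod C g = Dom C f"
    "g \<cdot> f = idt C (Dom C f)" "f \<cdot> g = idt C (Cod C f)" "is_iso C g"
proof -
  obtain g where "f \<in> Arr C" "g \<in> Arr C" "Dom C g = Cod C f" "Cod C g = Dom C f"
    "g \<cdot> f = idt C (Dom C f)" "f \<cdot> g = idt C (Cod C f)"
    using assms unfolding is_iso_def by auto
  moreover from this have "is_iso C g" by (intro is_isoI[of g f]) auto
  ultimately show thesis using that by blast
qed

lemma iso_monic:
  assumes "is_iso C f"
  shows "monic C f"
proof -
  obtain g where g: "f \<in> Arr C" "g \<in> Arr C" "Dom C g = Cod C f" "Cod C g = Dom C f"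
    "g \<cdot> f = idt C (Dom C f)"
    using assms by (rule is_isoE)
  show ?thesis
  proof (rule monicI)
    fix a b assume ab: "a \<in> Arr C" "b \<in> Arr C" "Cod C a = Dom C f" "Cod C b = Dom C f"
      "Dom C a = Dom C b" "f \<cdot> a = f \<cdot> b"
    have "(g \<cdot> f) \<cdot> a = (g \<cdot> f) \<cdot> b"
      using ab g(1-4) by (simp add: assoc)
    then show "a = b" using ab g(5) by simp
  qed (fact g)
qed

lemma split_monic:
  assumes "s \<in> Arr C" "p \<in> Arr C" "Dom C p = Cod C s" "Cod C p = Dom C s"
    "p \<cdot> s = idt C (Dom C s)"
  shows "monic C s"
proof (rule monicI)
  fix a b assume ab: "a \<in> Arr C" "b \<in> Arr C" "Cod C a = Dom C s" "Cod C b = Dom C s"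
    "Dom C a = Dom C b" "s \<cdot> a = s \<cdot> b"
  have "(p \<cdot> s) \<cdot> a = (p \<cdot> s) \<cdot> b"
    using ab assms(1-4) by (simp add: assoc)
  then show "a = b" using ab assms(5) by simp
qed (fact assms)

text \<open>Cancelling \<open>m\<close> in
  \<open>m \<cdot> (s \<cdot> m) = m \<cdot> idt C (Dom C m)\<close> makes the section two-sided.
  Counits, kernels and image inclusions are recognised as isomorphisms in this way.\<close>

lemma monic_split_epi_iso:
  assumes "monic C m" "s \<in> Arr C" "Dom C s = Cod C m" "Cod C s = Dom C m"
    "m \<cdot> s = idt C (Cod C m)"
  shows "is_iso C m"
proof -
  have m: "m \<in> Arr C" using assms(1) by (rule monic_Arr)
  have "m \<cdot> (s \<cdot> m) = m \<cdot> idt C (Dom C m)"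
    using assms m assoc[of m s m] by simp
  then have "s \<cdot> m = idt C (Dom C m)"
    using assms m by - (rule monicD[OF assms(1)], auto)
  then show ?thesis using assms m by (intro is_isoI[of m s]) auto
qed

lemma comp_iso:
  assumes "is_iso C f" "is_iso C g" "Cod C f = Dom C g"
  shows "is_iso C (g \<cdot> f)"
proof -
  obtain f' where f: "f \<in> Arr C" "f' \<in> Arr C" "Dom C f' = Cod C f" "Cod C f' = Dom C f"
    "f' \<cdot> f = idt C (Dom C f)" "f \<cdot> f' = idt C (Cod C f)"
    using assms(1) by (rule is_isoE)
  obtain g' where g: "g \<in> Arr C" "g' \<in> Arr C" "Dom C g' = Cod C g" "Cod C g' = Dom C g"
    "g' \<cdot> g = idt C (Dom C g)" "g \<cdot> g' = idt C (Cod C g)"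
    using assms(2) by (rule is_isoE)
  have "(f' \<cdot> g') \<cdot> (g \<cdot> f) = f' \<cdot> ((g' \<cdot> g) \<cdot> f)"
    using f(1-4) g(1-4) assms(3) by (simp add: assoc)
  moreover have "(g \<cdot> f) \<cdot> (f' \<cdot> g') = g \<cdot> ((f \<cdot> f') \<cdot> g')"
    using f(1-4) g(1-4) assms(3) by (simp add: assoc)
  ultimately show ?thesis
    using f g assms(3) by (intro is_isoI[of "g \<cdot> f" "f' \<cdot> g'"]) auto
qed

lemma iso_objectsI:
  "is_iso C f \<Longrightarrow> Dom C f = A \<Longrightarrow> Cod C f = B \<Longrightarrow> iso_objects C A B"
  unfolding iso_objects_def is_iso_def by auto

lemma full_repleteD:
  assumes "full_replete C S" "is_iso C f"
  shows "Dom C f \<in> S \<longleftrightarrow> Cod C f \<in> S"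
proof -
  obtain g where "f \<in> Arr C" "is_iso C g" "Dom C g = Cod C f" "Cod C g = Dom C f"
    using assms(2) by (rule is_isoE)
  then show ?thesis
    using assms iso_objectsI[of f] iso_objectsI[of g] unfolding full_replete_def
    by (metis dom_cod_Obj)
qed

section \<open>Pullbacks and regular epimorphisms\<close>

lemma pullbackD:
  assumes "is_pullback C f g p q"
  shows "f \<in> Arr C" "g \<in> Arr C" "p \<in> Arr C" "q \<in> Arr C"
     "Cod C f = Cod C g" "Dom C p = Dom C q" "Cod C p = Dom C f" "Cod C q = Dom C g"
     "f \<cdot> p = g \<cdot> q"
  using assms unfolding is_pullback_def by auto

lemma pullback_universal:
  assumes "is_pullback C f g p q" "a \<in> Arr C" "b \<in> Arr C" "Cod C a = Dom C f"
    "Cod C b = Dom C g" "Dom C a = Dom C b" "f \<cdot> a = g \<cdot> b"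
  shows "\<exists>!u. u \<in> Hom C (Dom C b) (Dom C p) \<and> p \<cdot> u = a \<and> q \<cdot> u = b"
proof -
  have "a \<in> Hom C (Dom C b) (Dom C f)" "b \<in> Hom C (Dom C b) (Dom C g)" "Dom C b \<in> Obj C"
    using assms by auto
  then show ?thesis using assms(1,7) unfolding is_pullback_def by blast
qed

lemma pullback_exists:
  assumes "is_pullback C f g p q" "a \<in> Arr C" "b \<in> Arr C" "Cod C a = Dom C f"
    "Cod C b = Dom C g" "Dom C a = Dom C b" "f \<cdot> a = g \<cdot> b"
  obtains u where "u \<in> Arr C" "Dom C u = Dom C b" "Cod C u = Dom C q" "p \<cdot> u = a" "q \<cdot> u = b"
  using pullback_universal[OF assms(1-7)] pullbackD(6)[OF assms(1)] that by auto

text \<open>Joint monicity of the projections: \<open>v\<close> itself supplies the cone to which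
  the universal property is applied.\<close>

lemma pullback_unique:
  assumes pb: "is_pullback C f g p q" and u: "u \<in> Arr C" "v \<in> Arr C" "Dom C u = Dom C v"
    "Cod C u = Dom C q" "Cod C v = Dom C q" "p \<cdot> u = p \<cdot> v" "q \<cdot> u = q \<cdot> v"
  shows "u = v"
proof -
  note D = pullbackD[OF pb]
  have "f \<cdot> (p \<cdot> v) = g \<cdot> (q \<cdot> v)"
    using D u assoc[of v p f] assoc[of v q g] by simp
  then have "\<exists>!w. w \<in> Hom C (Dom C v) (Dom C p) \<and> p \<cdot> w = p \<cdot> v \<and> q \<cdot> w = q \<cdot> v"
    using D u pullback_universal[OF pb, of "p \<cdot> v" "q \<cdot> v"] by simp
  then show ?thesis using D u by auto
qed

lemma pullbackI:
  assumes "f \<in> Arr C" "g \<in> Arr C" "p \<in> Arr C" "q \<in> Arr C"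
     "Cod C f = Cod C g" "Dom C p = Dom C q" "Cod C p = Dom C f" "Cod C q = Dom C g"
     "f \<cdot> p = g \<cdot> q"
    and "\<And>a b. \<lbrakk>a \<in> Arr C; b \<in> Arr C; Cod C a = Dom C f; Cod C b = Dom C g;
      Dom C a = Dom C b; f \<cdot> a = g \<cdot> b\<rbrakk> \<Longrightarrow>
      \<exists>u. u \<in> Arr C \<and> Dom C u = Dom C b \<and> Cod C u = Dom C q \<and> p \<cdot> u = a \<and> q \<cdot> u = b"
    and "\<And>u v. \<lbrakk>u \<in> Arr C; v \<in> Arr C; Dom C u = Dom C v; Cod C u = Dom C q; Cod C v = Dom C q;
       p \<cdot> u = p \<cdot> v; q \<cdot> u = q \<cdot> v\<rbrakk> \<Longrightarrow> u = v"
  shows "is_pullback C f g p q"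
  unfolding is_pullback_def
proof (intro conjI ballI impI)
  fix X a b assume "X \<in> Obj C" "a \<in> Hom C X (Dom C f)" "b \<in> Hom C X (Dom C g)" "f \<cdot> a = g \<cdot> b"
  then show "\<exists>!u. u \<in> Hom C X (Dom C p) \<and> p \<cdot> u = a \<and> q \<cdot> u = b"
    using assms(10)[of a b] assms(6,11) by (auto 0 4)
qed (use assms in auto)

lemma pullback_monic:
  assumes pb: "is_pullback C f g p q" and "monic C g"
  shows "monic C p"
proof (rule monicI)
  note D = pullbackD[OF pb]
  show "p \<in> Arr C" by fact
  fix u v assume u: "u \<in> Arr C" "v \<in> Arr C" "Cod C u = Dom C p" "Cod C v = Dom C p"
    "Dom C u = Dom C v" "p \<cdot> u = p \<cdot> v"
  have "g \<cdot> (q \<cdot> u) = f \<cdot> (p \<cdot> u)" "g \<cdot> (q \<cdot> v) = f \<cdot> (p \<cdot> v)"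
    using D u assoc[of u p f] assoc[of u q g] assoc[of v p f] assoc[of v q g] by simp_all
  then have "q \<cdot> u = q \<cdot> v"
    using D u by - (rule monicD[OF assms(2)], auto)
  then show "u = v" using u D by - (rule pullback_unique[OF pb], auto)
qed

lemma pullback_paste:
  assumes pb: "is_pullback C f g p q" and pb': "is_pullback C q h p' q'"
  shows "is_pullback C f (g \<cdot> h) (p \<cdot> p') q'"
proof -
  note D = pullbackD[OF pb] and D' = pullbackD[OF pb']
  show ?thesis
  proof (rule pullbackI)
    show "f \<cdot> (p \<cdot> p') = (g \<cdot> h) \<cdot> q'"
      using D D' assoc[of p' p f] assoc[of p' q g] assoc[of q' h g] by simp
  next
    fix a b assume ab: "a \<in> Arr C" "b \<in> Arr C" "Cod C a = Dom C f" "Cod C b = Dom C (g \<cdot> h)"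
      "Dom C a = Dom C b" "f \<cdot> a = g \<cdot> h \<cdot> b"
    have "f \<cdot> a = g \<cdot> (h \<cdot> b)" using ab D D' assoc[of b h g] by simp
    then obtain u where u: "u \<in> Arr C" "Dom C u = Dom C b" "Cod C u = Dom C q"
      "p \<cdot> u = a" "q \<cdot> u = h \<cdot> b"
      using ab D D' pullback_exists[OF pb, of a "h \<cdot> b"] by auto
    obtain v where v: "v \<in> Arr C" "Dom C v = Dom C b" "Cod C v = Dom C q'"
      "p' \<cdot> v = u" "q' \<cdot> v = b"
      using ab D D' u pullback_exists[OF pb', of u b] by auto
    show "\<exists>u. u \<in> Arr C \<and> Dom C u = Dom C b \<and> Cod C u = Dom C q' \<and> p \<cdot> p' \<cdot> u = a \<and> q' \<cdot> u = b"
      using v u D D' by (intro exI[of _ v]) (auto simp: assoc)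
  next
    fix u v assume u: "u \<in> Arr C" "v \<in> Arr C" "Dom C u = Dom C v" "Cod C u = Dom C q'"
      "Cod C v = Dom C q'" "p \<cdot> p' \<cdot> u = p \<cdot> p' \<cdot> v" "q' \<cdot> u = q' \<cdot> v"
    have "p \<cdot> (p' \<cdot> u) = p \<cdot> (p' \<cdot> v)" using u D D' by (simp add: assoc)
    moreover have "q \<cdot> (p' \<cdot> u) = q \<cdot> (p' \<cdot> v)"
      using u D D' assoc[of u p' q] assoc[of v p' q] assoc[of u q' h] assoc[of v q' h] by simp
    ultimately have "p' \<cdot> u = p' \<cdot> v"
      using u D D' by - (rule pullback_unique[OF pb], auto)
    then show "u = v" using u D D' by - (rule pullback_unique[OF pb'], auto)
  qed (use D D' in auto)
qed

text \<open>The cancellation half of the pasting law. The arrow induced by the outer square has the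
  right composite with \<open>p'\<close> because \<open>p\<close> and \<open>q\<close> are jointly
  monic.\<close>

lemma pullback_cancel:
  assumes pb: "is_pullback C f g p q" and outer: "is_pullback C f (g \<cdot> h) (p \<cdot> p') q'"
    and h: "h \<in> Arr C" "Cod C h = Dom C g" "p' \<in> Arr C" "Cod C p' = Dom C q" "Dom C p' = Dom C q'"
    and comm: "q \<cdot> p' = h \<cdot> q'"
  shows "is_pullback C q h p' q'"
proof -
  note D = pullbackD[OF pb] and D' = pullbackD[OF outer]
  have q': "q' \<in> Arr C" "Cod C q' = Dom C h" using D D' h by auto
  show ?thesis
  proof (rule pullbackI)
    fix a b assume ab: "a \<in> Arr C" "b \<in> Arr C" "Cod C a = Dom C q" "Cod C b = Dom C h"
      "Dom C a = Dom C b" "q \<cdot> a = h \<cdot> b"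
    have "f \<cdot> (p \<cdot> a) = (g \<cdot> h) \<cdot> b"
      using ab D h assoc[of a p f] assoc[of a q g] assoc[of b h g] by simp
    then obtain u where u: "u \<in> Arr C" "Dom C u = Dom C b" "Cod C u = Dom C q'"
      "(p \<cdot> p') \<cdot> u = p \<cdot> a" "q' \<cdot> u = b"
      using ab D h pullback_exists[OF outer, of "p \<cdot> a" b] by auto
    have "p' \<cdot> u = a"
      using u ab D h q' comm assoc[of u p' p] assoc[of u p' q] assoc[of u q' h] by - (rule pullback_unique[OF pb], auto)
    then show "\<exists>u. u \<in> Arr C \<and> Dom C u = Dom C b \<and> Cod C u = Dom C q' \<and> p' \<cdot> u = a \<and> q' \<cdot> u = b"
      using u by auto
  next
    fix u v assume "u \<in> Arr C" "v \<in> Arr C" "Dom C u = Dom C v" "Cod C u = Dom C q'"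
      "Cod C v = Dom C q'" "p' \<cdot> u = p' \<cdot> v" "q' \<cdot> u = q' \<cdot> v"
    then show "u = v"
      using D h by - (rule pullback_unique[OF outer], auto simp: assoc)
  qed (use D q' h comm in auto)
qed

lemma coequalizer_universal:
  assumes "is_coequalizer C f g e" "h \<in> Arr C" "Dom C h = Dom C e" "h \<cdot> f = h \<cdot> g"
  shows "\<exists>!u. u \<in> Hom C (Cod C e) (Cod C h) \<and> u \<cdot> e = h"
proof -
  have "Dom C e = Cod C f" using assms(1) unfolding is_coequalizer_def by blast
  then have "h \<in> Hom C (Cod C f) (Cod C h)" "Cod C h \<in> Obj C" using assms(2,3) by auto
  moreover have "\<forall>X\<in>Obj C. \<forall>h\<in>Hom C (Cod C f) X. h \<cdot> f = h \<cdot> g \<longrightarrow>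
      (\<exists>!u. u \<in> Hom C (Cod C e) X \<and> u \<cdot> e = h)"
    using assms(1) unfolding is_coequalizer_def by (elim conjE)
  ultimately show ?thesis using assms(4) by (metis (lifting))
qed

lemma regular_epiE:
  assumes "regular_epi C e"
  obtains f g where "f \<in> Arr C" "g \<in> Arr C" "e \<in> Arr C" "Dom C f = Dom C g" "Cod C f = Dom C e"
    "Cod C g = Dom C e" "e \<cdot> f = e \<cdot> g"
    "\<And>h. h \<in> Arr C \<Longrightarrow> Dom C h = Dom C e \<Longrightarrow> h \<cdot> f = h \<cdot> g \<Longrightarrow>
      \<exists>!u. u \<in> Hom C (Cod C e) (Cod C h) \<and> u \<cdot> e = h"
proof -
  obtain f g where fg: "is_coequalizer C f g e" using assms unfolding regular_epi_def by auto
  show thesis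
  proof (rule that[of f g])
    fix h assume "h \<in> Arr C" "Dom C h = Dom C e" "h \<cdot> f = h \<cdot> g"
    then show "\<exists>!u. u \<in> Hom C (Cod C e) (Cod C h) \<and> u \<cdot> e = h"
      by (rule coequalizer_universal[OF fg])
  qed (use fg in \<open>auto simp: is_coequalizer_def\<close>)
qed

lemma regular_epi_Arr: "regular_epi C e \<Longrightarrow> e \<in> Arr C"
  by (auto simp: regular_epi_def is_coequalizer_def)

lemma regular_epi_cancel:
  assumes "regular_epi C e" "u \<in> Arr C" "v \<in> Arr C" "Dom C u = Cod C e" "Dom C v = Cod C e"
    "Cod C u = Cod C v" "u \<cdot> e = v \<cdot> e"
  shows "u = v"
proof -
  obtain f g where fg: "f \<in> Arr C" "g \<in> Arr C" "e \<in> Arr C" "Dom C f = Dom C g"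
    "Cod C f = Dom C e" "Cod C g = Dom C e" "e \<cdot> f = e \<cdot> g"
    "\<And>h. h \<in> Arr C \<Longrightarrow> Dom C h = Dom C e \<Longrightarrow> h \<cdot> f = h \<cdot> g \<Longrightarrow>
      \<exists>!u. u \<in> Hom C (Cod C e) (Cod C h) \<and> u \<cdot> e = h"
    using assms(1) by (rule regular_epiE) blast
  have "(v \<cdot> e) \<cdot> f = (v \<cdot> e) \<cdot> g" using fg(1-7) assms by (simp add: assoc)
  then have "\<exists>!w. w \<in> Hom C (Cod C e) (Cod C (v \<cdot> e)) \<and> w \<cdot> e = v \<cdot> e"
    using fg(1-7) assms by (intro fg(8)) auto
  then show ?thesis using assms fg(3) by auto
qed

text \<open>Since \<open>m\<close> is monic, \<open>u\<close> coequalizes the pair that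
  \<open>e\<close> coequalizes. Hence \<open>u\<close> factors through \<open>e\<close>, and the
  factor is a section of \<open>m\<close>.\<close>

lemma regular_epi_through_monic_iso:
  assumes e: "regular_epi C e" and m: "monic C m" and u: "u \<in> Arr C" "Cod C u = Dom C m"
    "e = m \<cdot> u"
  shows "is_iso C m"
proof -
  obtain f g where fg: "f \<in> Arr C" "g \<in> Arr C" "e \<in> Arr C" "Dom C f = Dom C g"
    "Cod C f = Dom C e" "Cod C g = Dom C e" "e \<cdot> f = e \<cdot> g"
    "\<And>h. h \<in> Arr C \<Longrightarrow> Dom C h = Dom C e \<Longrightarrow> h \<cdot> f = h \<cdot> g \<Longrightarrow>
      \<exists>!u. u \<in> Hom C (Cod C e) (Cod C h) \<and> u \<cdot> e = h"
    using e by (rule regular_epiE) blast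
  note mA = monic_Arr[OF m]
  have de: "Dom C e = Dom C u" "Cod C e = Cod C m" using u mA by auto
  have "m \<cdot> (u \<cdot> f) = m \<cdot> (u \<cdot> g)"
    using fg(1-7) u mA de assoc[of f u m] assoc[of g u m] by simp
  then have "u \<cdot> f = u \<cdot> g"
    using fg(1-7) u mA de by - (rule monicD[OF m], auto)
  then obtain s where s: "s \<in> Arr C" "Dom C s = Cod C e" "Cod C s = Cod C u" "s \<cdot> e = u"
    using fg(8)[of u] u de by auto
  have "(m \<cdot> s) \<cdot> e = idt C (Cod C m) \<cdot> e"
    using s u mA de fg(3) assoc[of e s m] by simp
  then have "m \<cdot> s = idt C (Cod C m)"
    using s u mA de by - (rule regular_epi_cancel[OF e], auto)
  then show ?thesis using s u m de by (intro monic_split_epi_iso) auto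
qed

end

section \<open>Images in a regular category\<close>

context regular_category
begin

lemma pullback_along:
  assumes "f \<in> Arr C" "g \<in> Arr C" "Cod C f = Cod C g"
  obtains p q where "is_pullback C f g p q"
  using has_pullbacks assms by blast

text \<open>\<open>e\<close> is the coequalizer of the kernel pair of \<open>c\<close>. That the
  induced \<open>m\<close> is monic rests on stability of regular epimorphisms: arrows identified by
  \<open>m\<close> lift along \<open>e\<close> on a cover of their domain, and lifts identified by
  \<open>c\<close> are identified by \<open>e\<close>.\<close>

lemma image_factorization:
  assumes c: "c \<in> Arr C"
  obtains m e where "monic C m" "regular_epi C e" "Cod C e = Dom C m" "c = m \<cdot> e"
proof -
  obtain p q where pb: "is_pullback C c c p q" using pullback_along[OF c c] by auto
  then obtain e where e: "is_coequalizer C p q e" using kernel_pair_coequalizer by blast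
  note D = pullbackD[OF pb]
  have re: "regular_epi C e" using e unfolding regular_epi_def by auto
  note eA = regular_epi_Arr[OF re]
  have de: "Dom C e = Dom C c" "e \<cdot> p = e \<cdot> q" using e D unfolding is_coequalizer_def by auto
  obtain m where m: "m \<in> Arr C" "Dom C m = Cod C e" "Cod C m = Cod C c" "m \<cdot> e = c"
    using coequalizer_universal[OF e c] D de by auto
  have "monic C m"
  proof (rule monicI)
    fix u v assume uv: "u \<in> Arr C" "v \<in> Arr C" "Cod C u = Dom C m" "Cod C v = Dom C m"
      "Dom C u = Dom C v" "m \<cdot> u = m \<cdot> v"
    \<comment> \<open>The cover is \<open>e1 \<cdot> e2\<close>: over it \<open>u\<close> lifts
      along \<open>e\<close> to \<open>u' \<cdot> e2\<close>, and \<open>v\<close> lifts to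
      \<open>v'\<close>.\<close>
    obtain u' e1 where pb1: "is_pullback C e u u' e1"
      by (rule pullback_along[of e u]) (use uv(1-5) eA m(1-3) in auto)
    note D1 = pullbackD[OF pb1]
    have r1: "regular_epi C e1" using regular_epi_stable[OF pb1 re] .
    obtain v' e2 where pb2: "is_pullback C e (v \<cdot> e1) v' e2"
      by (rule pullback_along[of e "v \<cdot> e1"]) (use uv(1-5) eA m(1-3) D1(3-8) in auto)
    note D2 = pullbackD[OF pb2]
    have r2: "regular_epi C e2" using regular_epi_stable[OF pb2 re] .
    note t = uv(1-5) D1(3-8) D2(3,4,6,7) eA m(1-3) de(1)
    have ce2: "Cod C e2 = Dom C e1" using D2(8) t by simp
    have eu: "e \<cdot> (u' \<cdot> e2) = u \<cdot> (e1 \<cdot> e2)"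
      using t ce2 assoc[of e2 u' e] assoc[of e2 e1 u] D1(9) by simp
    have ev: "e \<cdot> v' = v \<cdot> (e1 \<cdot> e2)"
      using t ce2 assoc[of e2 e1 v] D2(9) by simp
    have "c \<cdot> (u' \<cdot> e2) = m \<cdot> (u \<cdot> (e1 \<cdot> e2))"
      using t ce2 assoc[of "u' \<cdot> e2" e m] m(4) eu by simp
    moreover have "c \<cdot> v' = m \<cdot> (v \<cdot> (e1 \<cdot> e2))"
      using t ce2 assoc[of v' e m] m(4) ev by simp
    moreover have "m \<cdot> (u \<cdot> (e1 \<cdot> e2)) = m \<cdot> (v \<cdot> (e1 \<cdot> e2))"
      using t ce2 uv(6) assoc[of "e1 \<cdot> e2" u m] assoc[of "e1 \<cdot> e2" v m] by simp
    ultimately obtain w where w: "w \<in> Arr C" "Cod C w = Dom C q" "p \<cdot> w = u' \<cdot> e2" "q \<cdot> w = v'"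
      using t ce2 pullback_exists[OF pb, of "u' \<cdot> e2" v'] by auto
    have "e \<cdot> (p \<cdot> w) = e \<cdot> (q \<cdot> w)"
      using D(3-8) t w(1,2) de(2) assoc[of w p e] assoc[of w q e] by simp
    then have "u \<cdot> (e1 \<cdot> e2) = v \<cdot> (e1 \<cdot> e2)" using w eu ev by simp
    \<comment> \<open>\<open>e2\<close> and then \<open>e1\<close> are cancelled separately, which
      avoids showing that their composite is a regular epimorphism.\<close>
    then have "u \<cdot> e1 = v \<cdot> e1"
      using t ce2 by - (rule regular_epi_cancel[OF r2], auto simp: assoc)
    then show "u = v" using t by - (rule regular_epi_cancel[OF r1], auto)
  qed fact
  then show thesis using that[of m e] re m by auto
qed

end

text \<open>The kernel pair projection of \<open>h\<close> is split by the diagonal \<open>s\<close>. If \<open>h'\<close> is monic, then the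
  pullback of this projection along \<open>g'\<close> is trivial, so protomodularity makes \<open>s\<close> invertible.\<close>

lemma pullback_reflects_monic:
  fixes C (structure)
  assumes "regular_category C" "protomodular_category C"
    and pb: "is_pullback C h g g' h'" and h': "monic C h'"
  shows "monic C h"
proof -
  interpret regular_category C by fact
  interpret protomodular_category C by fact
  note D = pullbackD[OF pb]
  obtain p q where kp: "is_pullback C h h p q" using pullback_along D by metis
  note K = pullbackD[OF kp]
  obtain s where s: "s \<in> Arr C" "Dom C s = Dom C h" "Cod C s = Dom C q"
    "p \<cdot> s = idt C (Dom C h)" "q \<cdot> s = idt C (Dom C h)"
    using pullback_exists[OF kp, of "idt C (Dom C h)" "idt C (Dom C h)"] K by auto
  have sp: "split_epi_with_section C p s"
    using s K unfolding split_epi_with_section_def by auto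
  obtain r v where rp: "is_pullback C p g' r v"
    using has_split_epi_pullbacks[OF sp, of g'] D K by auto
  note R = pullbackD[OF rp]
  note t = D(1-8) K(1-8) R(3,4,6-8) s(1-3)
  \<comment> \<open>The arrow \<open>w\<close> induced by \<open>q \<cdot> r\<close> and
    \<open>h' \<cdot> v\<close> agrees with \<open>v\<close> after \<open>h'\<close>, so
    \<open>q \<cdot> r = g' \<cdot> v\<close>. As also \<open>p \<cdot> r = g' \<cdot> v\<close>,
    the arrow \<open>r\<close> lies on the diagonal.\<close>
  have "h \<cdot> (q \<cdot> r) = g \<cdot> (h' \<cdot> v)"
    using t assoc[of r q h] assoc[of r p h] assoc[of v g' h] assoc[of v h' g] D(9) K(9) R(9)
    by simp
  then obtain w where w: "w \<in> Arr C" "Dom C w = Dom C v" "Cod C w = Dom C h'"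
    "g' \<cdot> w = q \<cdot> r" "h' \<cdot> w = h' \<cdot> v"
    using t pullback_exists[OF pb, of "q \<cdot> r" "h' \<cdot> v"] by auto
  have "w = v" using w t by - (rule monicD[OF h'], auto)
  then have qr: "q \<cdot> r = g' \<cdot> v" using w by simp
  have "p \<cdot> (s \<cdot> (g' \<cdot> v)) = p \<cdot> r" "q \<cdot> (s \<cdot> (g' \<cdot> v)) = q \<cdot> r"
    using t qr R(9) s(4,5) assoc[of "g' \<cdot> v" s p] assoc[of "g' \<cdot> v" s q] by simp_all
  then have rs: "s \<cdot> (g' \<cdot> v) = r"
    using t by - (rule pullback_unique[OF kp], auto)
  \<comment> \<open>The pair \<open>r\<close>, \<open>s\<close> is jointly extremally epimorphic,
    and both of its members factor through the monic \<open>s\<close>.\<close>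
  have "monic C s" using s t by (intro split_monic[of s p]) auto
  moreover have "\<exists>f'\<in>Hom C (Dom C r) (Dom C s). s \<cdot> f' = r"
    using rs t by (intro bexI[of _ "g' \<cdot> v"]) auto
  moreover have "\<exists>f'\<in>Hom C (Dom C s) (Dom C s). s \<cdot> f' = s"
    using t by (intro bexI[of _ "idt C (Dom C s)"]) auto
  moreover have "Cod C s = Cod C r" using t by simp
  ultimately have "is_iso C s"
    using protomodular[OF sp rp] unfolding jointly_extremally_epi_def by blast
  then obtain s' where s': "s' \<in> Arr C" "Dom C s' = Cod C s" "Cod C s' = Dom C s"
    "s \<cdot> s' = idt C (Cod C s)"
    by (rule is_isoE)
  have "p \<cdot> (s \<cdot> s') = q \<cdot> (s \<cdot> s')"
    using s s' t assoc[of s' s p] assoc[of s' s q] by simp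
  then have pq: "p = q" using s' t by simp
  show ?thesis
  proof (rule monicI)
    fix a b assume "a \<in> Arr C" "b \<in> Arr C" "Cod C a = Dom C h" "Cod C b = Dom C h"
      "Dom C a = Dom C b" "h \<cdot> a = h \<cdot> b"
    then obtain u where "p \<cdot> u = a" "q \<cdot> u = b" using pullback_exists[OF kp, of a b] by auto
    then show "a = b" using pq by simp
  qed fact
qed

lemma (in category) regular_epi_iso_comp:
  assumes e: "regular_epi C e" and i: "is_iso C i" and "Cod C e = Dom C i"
  shows "regular_epi C (i \<cdot> e)"
proof -
  obtain f g where fg: "is_coequalizer C f g e" using e unfolding regular_epi_def by auto
  obtain j where j: "i \<in> Arr C" "j \<in> Arr C" "Dom C j = Cod C i" "Cod C j = Dom C i"
    "j \<cdot> i = idt C (Dom C i)" "i \<cdot> j = idt C (Cod C i)"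
    using i by (rule is_isoE)
  have D: "f \<in> Arr C" "g \<in> Arr C" "e \<in> Arr C" "Dom C f = Dom C g" "Cod C f = Cod C g"
    "Dom C e = Cod C f" "e \<cdot> f = e \<cdot> g"
    using fg unfolding is_coequalizer_def by blast+
  have ji: "j \<cdot> (i \<cdot> e) = e" using j D(3) assms(3) assoc[of e i j] by simp
  have uni: "\<exists>!u. u \<in> Hom C (Cod C (i \<cdot> e)) X \<and> u \<cdot> (i \<cdot> e) = h"
    if h: "h \<in> Hom C (Cod C f) X" "h \<cdot> f = h \<cdot> g" for X h
  proof (rule ex_ex1I)
    obtain u where u: "u \<in> Arr C" "Dom C u = Cod C e" "Cod C u = X" "u \<cdot> e = h"
      using coequalizer_universal[OF fg, of h] h D(6) by auto
    have "(u \<cdot> j) \<cdot> (i \<cdot> e) = h"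
      using u j(1-4) ji D(3) assms(3) assoc[of "i \<cdot> e" j u] by simp
    then show "\<exists>u. u \<in> Hom C (Cod C (i \<cdot> e)) X \<and> u \<cdot> (i \<cdot> e) = h"
      using u j(1-4) D(3) assms(3) by (intro exI[of _ "u \<cdot> j"]) simp
  next
    fix u v assume uv: "u \<in> Hom C (Cod C (i \<cdot> e)) X \<and> u \<cdot> (i \<cdot> e) = h"
      "v \<in> Hom C (Cod C (i \<cdot> e)) X \<and> v \<cdot> (i \<cdot> e) = h"
    have "u \<cdot> i = v \<cdot> i"
      using uv j(1) D(3) assms(3) by - (rule regular_epi_cancel[OF e], auto simp: assoc)
    then have "(u \<cdot> i) \<cdot> j = (v \<cdot> i) \<cdot> j" by simp
    then show "u = v" using uv j D(3) assms(3) by (simp add: assoc)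
  qed
  have "(i \<cdot> e) \<cdot> f = (i \<cdot> e) \<cdot> g" using D j(1) assms(3) by (simp add: assoc)
  then have "is_coequalizer C f g (i \<cdot> e)"
    using D(1-6) j(1) assms(3) unfolding is_coequalizer_def
    by (intro conjI ballI impI uni) simp_all
  then show ?thesis unfolding regular_epi_def by blast
qed

lemma (in category) pullback_sym:
  assumes "is_pullback C f g p q"
  shows "is_pullback C g f q p"
proof -
  note D = pullbackD[OF assms]
  show ?thesis
  proof (rule pullbackI)
    fix a b assume "a \<in> Arr C" "b \<in> Arr C" "Cod C a = Dom C g" "Cod C b = Dom C f"
      "Dom C a = Dom C b" "g \<cdot> a = f \<cdot> b"
    then show "\<exists>u. u \<in> Arr C \<and> Dom C u = Dom C b \<and> Cod C u = Dom C p \<and> q \<cdot> u = a \<and> p \<cdot> u = b"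
      using pullback_exists[OF assms, of b a] D by metis
  next
    fix u v assume "u \<in> Arr C" "v \<in> Arr C" "Dom C u = Dom C v" "Cod C u = Dom C p"
      "Cod C v = Dom C p" "q \<cdot> u = q \<cdot> v" "p \<cdot> u = p \<cdot> v"
    then show "u = v" using D by - (rule pullback_unique[OF assms], auto)
  qed (use D in auto)
qed

text \<open>The two cospans have the same cones because \<open>m\<close> cancels. Applied to
  isomorphisms \<open>m\<close>, in order to replace the codomain of a reflection by an isomorphic
  object.\<close>

lemma (in category) pullback_comp_monic_iff:
  assumes m: "monic C m" and f: "f \<in> Arr C" "g \<in> Arr C" "Cod C f = Dom C m" "Cod C g = Dom C m"
  shows "is_pullback C (m \<cdot> f) (m \<cdot> g) p q \<longleftrightarrow> is_pullback C f g p q"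
proof -
  note mA = monic_Arr[OF m]
  have iff: "(m \<cdot> f) \<cdot> a = (m \<cdot> g) \<cdot> b \<longleftrightarrow> f \<cdot> a = g \<cdot> b"
    if "a \<in> Arr C" "b \<in> Arr C" "Cod C a = Dom C f" "Cod C b = Dom C g" "Dom C a = Dom C b" for a b
  proof
    assume "(m \<cdot> f) \<cdot> a = (m \<cdot> g) \<cdot> b"
    then have "m \<cdot> (f \<cdot> a) = m \<cdot> (g \<cdot> b)" using that mA f assoc[of a f m] assoc[of b g m] by simp
    then show "f \<cdot> a = g \<cdot> b" using that mA f by - (rule monicD[OF m], auto)
  next
    assume "f \<cdot> a = g \<cdot> b"
    then show "(m \<cdot> f) \<cdot> a = (m \<cdot> g) \<cdot> b"
      using that mA f assoc[of a f m] assoc[of b g m] by simp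
  qed
  show ?thesis
  proof
    assume pb: "is_pullback C (m \<cdot> f) (m \<cdot> g) p q"
    note D = pullbackD[OF pb]
    show "is_pullback C f g p q"
    proof (rule pullbackI)
      show "f \<cdot> p = g \<cdot> q" using iff[of p q] D mA f by simp
    next
      fix a b assume ab: "a \<in> Arr C" "b \<in> Arr C" "Cod C a = Dom C f" "Cod C b = Dom C g"
        "Dom C a = Dom C b" "f \<cdot> a = g \<cdot> b"
      then have "(m \<cdot> f) \<cdot> a = (m \<cdot> g) \<cdot> b" using iff by simp
      then show "\<exists>u. u \<in> Arr C \<and> Dom C u = Dom C b \<and> Cod C u = Dom C q \<and> p \<cdot> u = a \<and> q \<cdot> u = b"
        using pullback_exists[OF pb, of a b] ab(1-5) mA f by (metis comp_simps(2))
    next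
      fix u v assume "u \<in> Arr C" "v \<in> Arr C" "Dom C u = Dom C v" "Cod C u = Dom C q"
        "Cod C v = Dom C q" "p \<cdot> u = p \<cdot> v" "q \<cdot> u = q \<cdot> v"
      then show "u = v" by - (rule pullback_unique[OF pb], auto)
    qed (use D mA f in auto)
  next
    assume pb: "is_pullback C f g p q"
    note D = pullbackD[OF pb]
    show "is_pullback C (m \<cdot> f) (m \<cdot> g) p q"
    proof (rule pullbackI)
      show "(m \<cdot> f) \<cdot> p = (m \<cdot> g) \<cdot> q" using iff[of p q] D by simp
    next
      fix a b assume ab: "a \<in> Arr C" "b \<in> Arr C" "Cod C a = Dom C (m \<cdot> f)"
        "Cod C b = Dom C (m \<cdot> g)" "Dom C a = Dom C b" "(m \<cdot> f) \<cdot> a = (m \<cdot> g) \<cdot> b"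
      have t: "Cod C a = Dom C f" "Cod C b = Dom C g" using ab(3,4) mA f by simp_all
      then have "f \<cdot> a = g \<cdot> b" using iff ab by simp
      then show "\<exists>u. u \<in> Arr C \<and> Dom C u = Dom C b \<and> Cod C u = Dom C q \<and> p \<cdot> u = a \<and> q \<cdot> u = b"
        using pullback_exists[OF pb, of a b] ab(1,2,5) t by metis
    next
      fix u v assume "u \<in> Arr C" "v \<in> Arr C" "Dom C u = Dom C v" "Cod C u = Dom C q"
        "Cod C v = Dom C q" "p \<cdot> u = p \<cdot> v" "q \<cdot> u = q \<cdot> v"
      then show "u = v" by - (rule pullback_unique[OF pb], auto)
    qed (use D mA f in auto)
  qed
qed

section \<open>Null arrows, kernels and cokernels\<close>

locale regular_category_with_zeros = regular_category C
  for C :: "('o, 'm, 'x) cat_scheme" (structure) +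
  fixes Z :: "'o set" and Zo :: "'o \<Rightarrow> 'o" and Zm :: "'m \<Rightarrow> 'm" and \<epsilon> :: "'o \<Rightarrow> 'm"
  assumes zeros: "class_of_zero_objects C Z Zo Zm \<epsilon>"
begin

abbreviation null :: "'m \<Rightarrow> bool" where
  "null f \<equiv> f \<in> null_arrows C Z"

lemma Z_full_replete: "full_replete C Z"
  using zeros unfolding class_of_zero_objects_def by (elim conjE)

lemma Z_coreflector: "coreflector C Z Zo Zm \<epsilon>"
  using zeros unfolding class_of_zero_objects_def by (elim conjE)

lemma Z_posetal:
  assumes "f \<in> Arr C" "g \<in> Arr C" "Dom C f = Dom C g" "Cod C f = Cod C g"
    "Dom C f \<in> Z" "Cod C f \<in> Z"
  shows "f = g"
proof -
  have "\<forall>V\<in>Z. \<forall>W\<in>Z. \<forall>f\<in>Hom C V W. \<forall>g\<in>Hom C V W. f = g"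
    using zeros unfolding class_of_zero_objects_def by (elim conjE)
  then show ?thesis using assms by (metis in_Hom)
qed

lemma Z_Obj: "W \<in> Z \<Longrightarrow> W \<in> Obj C"
  using Z_full_replete unfolding full_replete_def by blast

lemma eps_simps [simp]:
  assumes "A \<in> Obj C"
  shows "\<epsilon> A \<in> Arr C" "Dom C (\<epsilon> A) = Zo A" "Cod C (\<epsilon> A) = A" "Zo A \<in> Z" "Zo A \<in> Obj C"
proof -
  have "(\<forall>A\<in>Obj C. \<epsilon> A \<in> Hom C (Zo A) A) \<and> functor_into C Z Zo Zm"
    using Z_coreflector unfolding coreflector_def by (elim conjE) (intro conjI)
  then show "\<epsilon> A \<in> Arr C" "Dom C (\<epsilon> A) = Zo A" "Cod C (\<epsilon> A) = A" "Zo A \<in> Z" "Zo A \<in> Obj C"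
    using assms Z_Obj unfolding functor_into_def by auto
qed

lemma eps_monic: "A \<in> Obj C \<Longrightarrow> monic C (\<epsilon> A)"
  using zeros unfolding class_of_zero_objects_def by blast

lemma eps_factor:
  assumes "g \<in> Arr C" "Dom C g \<in> Z"
  obtains h where "h \<in> Arr C" "Dom C h = Dom C g" "Cod C h = Zo (Cod C g)"
    "\<epsilon> (Cod C g) \<cdot> h = g"
proof -
  have "\<forall>A\<in>Obj C. \<forall>W\<in>Z. \<forall>g\<in>Hom C W A. \<exists>!h. h \<in> Hom C W (Zo A) \<and> \<epsilon> A \<cdot> h = g"
    using Z_coreflector unfolding coreflector_def by (elim conjE)
  then show thesis using assms that by (metis in_Hom cod_in_Obj)
qed

text \<open>Naturality of the counit turns the inverse of \<open>Zm m\<close> into a factorization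
  of the counit of the codomain through \<open>m\<close>: a subobject contains the whole
  coreflection of the ambient object.\<close>

lemma monic_Zm:
  assumes "monic C m"
  obtains z where "z \<in> Arr C" "Dom C z = Zo (Cod C m)" "Cod C z = Zo (Dom C m)"
    "m \<cdot> (\<epsilon> (Dom C m) \<cdot> z) = \<epsilon> (Cod C m)"
proof -
  note mA = monic_Arr[OF assms]
  have "is_iso C (Zm m)" using zeros assms unfolding class_of_zero_objects_def by blast
  then obtain z where z: "Zm m \<in> Arr C" "z \<in> Arr C" "Dom C z = Cod C (Zm m)"
    "Cod C z = Dom C (Zm m)" "Zm m \<cdot> z = idt C (Cod C (Zm m))"
    by (rule is_isoE)
  have "functor_into C Z Zo Zm \<and> (\<forall>f \<in> Arr C. f \<cdot> \<epsilon> (Dom C f) = \<epsilon> (Cod C f) \<cdot> Zm f)"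
    using Z_coreflector unfolding coreflector_def by (elim conjE) (intro conjI)
  then have t: "Dom C (Zm m) = Zo (Dom C m)" "Cod C (Zm m) = Zo (Cod C m)"
    "m \<cdot> \<epsilon> (Dom C m) = \<epsilon> (Cod C m) \<cdot> Zm m"
    using mA unfolding functor_into_def by auto
  have "m \<cdot> (\<epsilon> (Dom C m) \<cdot> z) = (m \<cdot> \<epsilon> (Dom C m)) \<cdot> z"
    using mA z t(1,2) by (simp add: assoc)
  also have "\<dots> = \<epsilon> (Cod C m) \<cdot> (Zm m \<cdot> z)"
    unfolding t(3) using mA z(1-4) t(1,2) by (simp add: assoc)
  also have "\<dots> = \<epsilon> (Cod C m)" using z t mA by simp
  finally show thesis using that z t by auto
qed

lemma null_arrowsI:
  assumes "a \<in> Arr C" "b \<in> Arr C" "Cod C a = Dom C b" "Cod C a \<in> Z" "f = b \<cdot> a"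
  shows "null f"
proof -
  have "a \<in> Hom C (Dom C f) (Cod C a)" "b \<in> Hom C (Cod C a) (Cod C f)" "f \<in> Arr C"
    using assms by auto
  then show ?thesis using assms(4,5) unfolding null_arrows_def by blast
qed

text \<open>The zero object in the middle of a null arrow may be replaced by the coreflection of the
  codomain, because the second half factors through the counit. Nullity thereby becomes membership
  in a subobject.\<close>

lemma null_factor:
  assumes "null f"
  obtains x where "x \<in> Arr C" "Dom C x = Dom C f" "Cod C x = Zo (Cod C f)" "\<epsilon> (Cod C f) \<cdot> x = f"
proof -
  obtain W a b where W: "f \<in> Arr C" "W \<in> Z" "a \<in> Arr C" "b \<in> Arr C" "Dom C a = Dom C f"
    "Cod C a = W" "Dom C b = W" "Cod C b = Cod C f" "f = b \<cdot> a"
    using assms unfolding null_arrows_def by (auto simp only: mem_Collect_eq in_Hom)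
  obtain h where h: "h \<in> Arr C" "Dom C h = W" "Cod C h = Zo (Cod C f)" "\<epsilon> (Cod C f) \<cdot> h = b"
    using eps_factor[of b] W(2,4,7,8) by auto
  have "\<epsilon> (Cod C f) \<cdot> (h \<cdot> a) = b \<cdot> a"
    using h W(1-8) assoc[of a h "\<epsilon> (Cod C f)"] by simp
  then have "\<epsilon> (Cod C f) \<cdot> (h \<cdot> a) = f" using W(9) by (rule trans[OF _ sym])
  then show thesis using that[of "h \<cdot> a"] h(1-3) W(3-7) by simp
qed

lemma null_Arr: "null f \<Longrightarrow> f \<in> Arr C"
  unfolding null_arrows_def by blast

lemma null_comp_right:
  assumes "null f" "g \<in> Arr C" "Cod C g = Dom C f"
  shows "null (f \<cdot> g)"
proof -
  note fA = null_Arr[OF assms(1)]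
  obtain x where x: "x \<in> Arr C" "Dom C x = Dom C f" "Cod C x = Zo (Cod C f)" "\<epsilon> (Cod C f) \<cdot> x = f"
    using null_factor[OF assms(1)] .
  have "f \<cdot> g = \<epsilon> (Cod C f) \<cdot> (x \<cdot> g)"
    using x fA assms(2,3) assoc[of g x "\<epsilon> (Cod C f)"] by simp
  then show ?thesis using x(1-3) fA assms(2,3) by (intro null_arrowsI[of "x \<cdot> g" "\<epsilon> (Cod C f)"]) auto
qed

lemma null_dom: "f \<in> Arr C \<Longrightarrow> Dom C f \<in> Z \<Longrightarrow> null f"
  by (intro null_arrowsI[of "idt C (Dom C f)" f]) auto

text \<open>The counit of \<open>Cod C m\<close> factors through \<open>m\<close>, so the null
  factorization of \<open>m \<cdot> f\<close> already takes place inside the domain of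
  \<open>m\<close>, and \<open>m\<close> cancels.\<close>

lemma null_cancel_monic:
  assumes m: "monic C m" and f: "f \<in> Arr C" "Cod C f = Dom C m" and null: "null (m \<cdot> f)"
  shows "null f"
proof -
  note mA = monic_Arr[OF m]
  obtain z where z: "z \<in> Arr C" "Dom C z = Zo (Cod C m)" "Cod C z = Zo (Dom C m)"
    "m \<cdot> (\<epsilon> (Dom C m) \<cdot> z) = \<epsilon> (Cod C m)"
    using monic_Zm[OF m] .
  obtain x where x: "x \<in> Arr C" "Dom C x = Dom C f" "Cod C x = Zo (Cod C m)"
    "\<epsilon> (Cod C m) \<cdot> x = m \<cdot> f"
    using null_factor[OF null] f mA by auto
  have "m \<cdot> f = m \<cdot> (\<epsilon> (Dom C m) \<cdot> (z \<cdot> x))"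
    using x z f mA assoc[of x "\<epsilon> (Dom C m) \<cdot> z" m] assoc[of x z "\<epsilon> (Dom C m)"] by simp
  then have "f = \<epsilon> (Dom C m) \<cdot> (z \<cdot> x)"
    using x(1-3) z(1-3) f mA by - (rule monicD[OF m], auto)
  then show ?thesis
    using x(1-3) z(1-3) mA by (intro null_arrowsI[of "z \<cdot> x" "\<epsilon> (Dom C m)"]) auto
qed

text \<open>A null factorization of the identity is a section of the monic counit, which is
  therefore invertible; repleteness of \<open>Z\<close> does the rest.\<close>

lemma null_idt_in_Z:
  assumes "null (idt C A)" "A \<in> Obj C"
  shows "A \<in> Z"
proof -
  obtain x where x: "x \<in> Arr C" "Dom C x = A" "Cod C x = Zo A" "\<epsilon> A \<cdot> x = idt C A"
    using null_factor[OF assms(1)] assms(2) by auto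
  then have "is_iso C (\<epsilon> A)"
    using assms(2) by (intro monic_split_epi_iso[of _ x] eps_monic) auto
  then show ?thesis using full_repleteD[OF Z_full_replete, of "\<epsilon> A"] assms(2) by simp
qed

lemma Z_kernelD:
  assumes "Z_kernel C Z f k"
  shows "f \<in> Arr C" "k \<in> Arr C" "Cod C k = Dom C f" "null (f \<cdot> k)"
  using assms unfolding Z_kernel_def by blast+

lemma Z_kernel_universal:
  assumes "Z_kernel C Z f k" "a \<in> Arr C" "Cod C a = Dom C f" "null (f \<cdot> a)"
  shows "\<exists>!u. u \<in> Hom C (Dom C a) (Dom C k) \<and> k \<cdot> u = a"
  using assms unfolding Z_kernel_def by blast

text \<open>Arrows \<open>a\<close> with \<open>f \<cdot> a\<close> null are the same as cones over
  \<open>f\<close> and the counit of its codomain. The second leg \<open>x\<close>, from the torsion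
  part to the coreflection, is the arrow that (M') is about.\<close>

lemma Z_kernel_pullback:
  assumes k: "Z_kernel C Z f k"
  obtains x where "is_pullback C f (\<epsilon> (Cod C f)) k x"
proof -
  note K = Z_kernelD[OF k]
  obtain x where x: "x \<in> Arr C" "Dom C x = Dom C k" "Cod C x = Zo (Cod C f)"
    "\<epsilon> (Cod C f) \<cdot> x = f \<cdot> k"
    using null_factor[OF K(4)] K(1-3) by auto
  have "is_pullback C f (\<epsilon> (Cod C f)) k x"
  proof (rule pullbackI)
    fix a b assume ab: "a \<in> Arr C" "b \<in> Arr C" "Cod C a = Dom C f" "Cod C b = Dom C (\<epsilon> (Cod C f))"
      "Dom C a = Dom C b" "f \<cdot> a = \<epsilon> (Cod C f) \<cdot> b"
    have cb: "Cod C b = Zo (Cod C f)" using ab(4) K(1) by simp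
    have "null (f \<cdot> a)"
      using ab cb K(1) by (intro null_arrowsI[of b "\<epsilon> (Cod C f)"]) auto
    then obtain u where u: "u \<in> Arr C" "Dom C u = Dom C a" "Cod C u = Dom C k" "k \<cdot> u = a"
      using Z_kernel_universal[OF k ab(1,3)] by auto
    have "\<epsilon> (Cod C f) \<cdot> (x \<cdot> u) = (f \<cdot> k) \<cdot> u"
      using u(1-3) x K(1-3) assoc[of u x "\<epsilon> (Cod C f)"] by simp
    also have "\<dots> = \<epsilon> (Cod C f) \<cdot> b" using u K(1-3) ab(6) by (simp add: assoc)
    finally have "x \<cdot> u = b"
      using u(1-3) x(1-3) K(1) ab(2,5) cb by - (rule monicD[OF eps_monic[of "Cod C f"]], auto)
    then show "\<exists>u. u \<in> Arr C \<and> Dom C u = Dom C b \<and> Cod C u = Dom C x \<and> k \<cdot> u = a \<and> x \<cdot> u = b"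
      using u ab(5) x(2) by metis
  next
    fix u v assume uv: "u \<in> Arr C" "v \<in> Arr C" "Dom C u = Dom C v" "Cod C u = Dom C x"
      "Cod C v = Dom C x" "k \<cdot> u = k \<cdot> v"
    have "null ((f \<cdot> k) \<cdot> v)" using uv x(2) K by - (rule null_comp_right, auto)
    then have "null (f \<cdot> (k \<cdot> v))" using uv x(2) K by (simp add: assoc)
    then show "u = v" using Z_kernel_universal[OF k, of "k \<cdot> v"] uv x(2) K by auto
  qed (use x K in auto)
  then show thesis using that by blast
qed

text \<open>Supplies the torsion part when only a reflection is given. Factorizations are unique
  because \<open>k\<close> is a pullback of a monic counit.\<close>

lemma pullback_Z_kernel:
  assumes pb: "is_pullback C f (\<epsilon> (Cod C f)) k x"
  shows "Z_kernel C Z f k"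
proof -
  note D = pullbackD[OF pb]
  have cx: "Cod C x = Zo (Cod C f)" using D(1,8) by simp
  have "null (f \<cdot> k)" using D cx by (intro null_arrowsI[of x "\<epsilon> (Cod C f)"]) auto
  moreover have "\<exists>!u. u \<in> Hom C (Dom C a) (Dom C k) \<and> k \<cdot> u = a"
    if a: "a \<in> Arr C" "Cod C a = Dom C f" "null (f \<cdot> a)" for a
  proof (rule ex_ex1I)
    obtain y where y: "y \<in> Arr C" "Dom C y = Dom C a" "Cod C y = Zo (Cod C f)"
      "\<epsilon> (Cod C f) \<cdot> y = f \<cdot> a"
      using null_factor[OF a(3)] a(1,2) D(1) by auto
    obtain u where "u \<in> Arr C" "Dom C u = Dom C y" "Cod C u = Dom C x" "k \<cdot> u = a"
      using pullback_exists[OF pb, of a y] a y D(1) by auto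
    then show "\<exists>u. u \<in> Hom C (Dom C a) (Dom C k) \<and> k \<cdot> u = a" using y D(6) by auto
  next
    fix u v assume "u \<in> Hom C (Dom C a) (Dom C k) \<and> k \<cdot> u = a"
      "v \<in> Hom C (Dom C a) (Dom C k) \<and> k \<cdot> v = a"
    moreover have "monic C k" using pullback_monic[OF pb] eps_monic D(1) by simp
    ultimately show "u = v" by - (rule monicD[of k], auto)
  qed
  ultimately show ?thesis using D unfolding Z_kernel_def by blast
qed

lemma Z_kernel_monic: "Z_kernel C Z f k \<Longrightarrow> monic C k"
  by (metis Z_kernel_pullback pullback_monic eps_monic Z_kernelD(1) dom_cod_Obj(2))

lemma Z_cokernelD:
  assumes "Z_cokernel C Z f c"
  shows "f \<in> Arr C" "c \<in> Arr C" "Dom C c = Cod C f" "null (c \<cdot> f)"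
  using assms unfolding Z_cokernel_def by blast+

lemma Z_cokernel_universal:
  assumes "Z_cokernel C Z f c" "a \<in> Arr C" "Dom C a = Cod C f" "null (a \<cdot> f)"
  shows "\<exists>!u. u \<in> Hom C (Cod C c) (Cod C a) \<and> u \<cdot> c = a"
  using assms unfolding Z_cokernel_def by blast

text \<open>In the image factorization \<open>c = m \<cdot> e\<close> the arrow \<open>e \<cdot> f\<close> is null, because \<open>m\<close> is monic. Hence
  \<open>e\<close> factors through the cokernel \<open>c\<close>, and \<open>m\<close> is invertible.\<close>

lemma Z_cokernel_regular_epi:
  assumes c: "Z_cokernel C Z f c"
  shows "regular_epi C c"
proof -
  note K = Z_cokernelD[OF c]
  obtain m e where me: "monic C m" "regular_epi C e" "Cod C e = Dom C m" "c = m \<cdot> e"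
    using image_factorization[OF K(2)] .
  note mA = monic_Arr[OF me(1)] and eA = regular_epi_Arr[OF me(2)]
  have t: "Dom C e = Cod C f" "Cod C m = Cod C c" using K me mA eA by auto
  have "null (m \<cdot> (e \<cdot> f))" using K me mA eA t by (simp add: assoc)
  then have "null (e \<cdot> f)"
    using K(1) me(3) eA t by - (rule null_cancel_monic[OF me(1)], auto)
  then obtain u where u: "u \<in> Arr C" "Dom C u = Cod C c" "Cod C u = Cod C e" "u \<cdot> c = e"
    using Z_cokernel_universal[OF c, of e] eA t by auto
  have cc: "(m \<cdot> u) \<cdot> c = c" using u me(3,4) mA K(2) assoc[of c u m] by simp
  have "\<exists>!u. u \<in> Hom C (Cod C c) (Cod C c) \<and> u \<cdot> c = c"
    using Z_cokernel_universal[OF c K(2,3,4)] .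
  moreover have "m \<cdot> u \<in> Hom C (Cod C c) (Cod C c)" "idt C (Cod C c) \<in> Hom C (Cod C c) (Cod C c)"
    "idt C (Cod C c) \<cdot> c = c"
    using u(1-3) mA me(3) t(2) K(2) by simp_all
  ultimately have mu: "m \<cdot> u = idt C (Cod C c)" using cc by blast
  then have "is_iso C m"
    using monic_split_epi_iso[OF me(1), of u] u(1-3) me(3) t by simp
  then show ?thesis using regular_epi_iso_comp[OF me(2)] me(3,4) by simp
qed

end

section \<open>Reflections as universal arrows\<close>

text \<open>A reflection of a single object, without a chosen functor. Unit components, second
  arrows of torsion sequences and pullbacks of reflections can all be compared in this form.\<close>

definition universal_arrow :: "('o, 'm, 'x) cat_scheme \<Rightarrow> 'o set \<Rightarrow> 'm \<Rightarrow> bool" where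
  "universal_arrow C S e \<longleftrightarrow> e \<in> Arr C \<and> Cod C e \<in> S \<and>
     (\<forall>g \<in> Arr C. Dom C g = Dom C e \<longrightarrow> Cod C g \<in> S \<longrightarrow>
        (\<exists>!h. h \<in> Hom C (Cod C e) (Cod C g) \<and> Comp C h e = g))"

context category
begin

lemma universal_arrowD:
  assumes "universal_arrow C S e"
  shows "e \<in> Arr C" "Cod C e \<in> S"
  using assms unfolding universal_arrow_def by blast+

lemma universal_arrow_ex1:
  assumes "universal_arrow C S e" "g \<in> Arr C" "Dom C g = Dom C e" "Cod C g \<in> S"
  shows "\<exists>!h. h \<in> Hom C (Cod C e) (Cod C g) \<and> h \<cdot> e = g"
  using assms unfolding universal_arrow_def by blast

lemma universal_arrow_factor:
  assumes "universal_arrow C S e" "g \<in> Arr C" "Dom C g = Dom C e" "Cod C g \<in> S"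
  obtains h where "h \<in> Arr C" "Dom C h = Cod C e" "Cod C h = Cod C g" "h \<cdot> e = g"
  using universal_arrow_ex1[OF assms] that by (metis in_Hom)

lemma universal_arrow_cancel:
  assumes e: "universal_arrow C S e" and u: "u \<in> Arr C" "v \<in> Arr C" "Dom C u = Cod C e"
    "Dom C v = Cod C e" "Cod C u = Cod C v" "Cod C v \<in> S" "u \<cdot> e = v \<cdot> e"
  shows "u = v"
proof -
  have "\<exists>!h. h \<in> Hom C (Cod C e) (Cod C (v \<cdot> e)) \<and> h \<cdot> e = v \<cdot> e"
    using u universal_arrowD[OF e] by - (rule universal_arrow_ex1[OF e], auto)
  moreover have "Cod C (v \<cdot> e) = Cod C v" using u universal_arrowD[OF e] by simp
  ultimately show ?thesis using u by (metis in_Hom)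
qed

lemma universal_arrowI:
  assumes "e \<in> Arr C" "Cod C e \<in> S"
    and "\<And>g. \<lbrakk>g \<in> Arr C; Dom C g = Dom C e; Cod C g \<in> S\<rbrakk> \<Longrightarrow>
      \<exists>h. h \<in> Arr C \<and> Dom C h = Cod C e \<and> Cod C h = Cod C g \<and> h \<cdot> e = g"
    and "\<And>u v. \<lbrakk>u \<in> Arr C; v \<in> Arr C; Dom C u = Cod C e; Dom C v = Cod C e;
      Cod C u = Cod C v; Cod C v \<in> S; u \<cdot> e = v \<cdot> e\<rbrakk> \<Longrightarrow> u = v"
  shows "universal_arrow C S e"
  unfolding universal_arrow_def
proof (intro conjI ballI impI)
  fix g assume g: "g \<in> Arr C" "Dom C g = Dom C e" "Cod C g \<in> S"
  show "\<exists>!h. h \<in> Hom C (Cod C e) (Cod C g) \<and> h \<cdot> e = g"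
  proof (rule ex_ex1I)
    show "\<exists>h. h \<in> Hom C (Cod C e) (Cod C g) \<and> h \<cdot> e = g"
      using assms(3)[OF g] by simp
  next
    fix u v assume "u \<in> Hom C (Cod C e) (Cod C g) \<and> u \<cdot> e = g"
      "v \<in> Hom C (Cod C e) (Cod C g) \<and> v \<cdot> e = g"
    then show "u = v" using g by - (rule assms(4), auto)
  qed
qed (use assms(1,2) in auto)

lemma universal_arrow_comparison_iso:
  assumes e: "universal_arrow C S e" and e': "universal_arrow C S e'"
    and h: "h \<in> Arr C" "Dom C h = Cod C e" "Cod C h = Cod C e'" "h \<cdot> e = e'"
  shows "is_iso C h"
proof -
  note E = universal_arrowD[OF e] and E' = universal_arrowD[OF e']
  have d: "Dom C e = Dom C e'" using h E comp_simps(2)[of e h] by simp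
  obtain k where k: "k \<in> Arr C" "Dom C k = Cod C e'" "Cod C k = Cod C e" "k \<cdot> e' = e"
    using universal_arrow_factor[OF e', of e] E d by auto
  have "(k \<cdot> h) \<cdot> e = idt C (Cod C e) \<cdot> e" "(h \<cdot> k) \<cdot> e' = idt C (Cod C e') \<cdot> e'"
    using h k E E' assoc[of e h k] assoc[of e' k h] by simp_all
  then have "k \<cdot> h = idt C (Cod C e)" "h \<cdot> k = idt C (Cod C e')"
    using h k E E' universal_arrow_cancel[OF e, of "k \<cdot> h" "idt C (Cod C e)"]
      universal_arrow_cancel[OF e', of "h \<cdot> k" "idt C (Cod C e')"] by simp_all
  then show ?thesis using h k by (intro is_isoI[of h k]) auto
qed

lemma universal_arrow_iso_comp:
  assumes e: "universal_arrow C S e" and i: "is_iso C i" "Dom C i = Cod C e" "Cod C i \<in> S"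
  shows "universal_arrow C S (i \<cdot> e)"
proof -
  note E = universal_arrowD[OF e]
  obtain j where j: "i \<in> Arr C" "j \<in> Arr C" "Dom C j = Cod C i" "Cod C j = Dom C i"
    "j \<cdot> i = idt C (Dom C i)" "i \<cdot> j = idt C (Cod C i)"
    using i(1) by (rule is_isoE)
  have ji: "j \<cdot> (i \<cdot> e) = e" using j i(2) E assoc[of e i j] by simp
  show ?thesis
  proof (rule universal_arrowI)
    fix g assume g: "g \<in> Arr C" "Dom C g = Dom C (i \<cdot> e)" "Cod C g \<in> S"
    obtain h where h: "h \<in> Arr C" "Dom C h = Cod C e" "Cod C h = Cod C g" "h \<cdot> e = g"
      using universal_arrow_factor[OF e, of g] g E j(1) i(2) by auto
    have "(h \<cdot> j) \<cdot> (i \<cdot> e) = g"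
      using h j(1-4) i(2) E ji assoc[of "i \<cdot> e" j h] by simp
    then show "\<exists>h. h \<in> Arr C \<and> Dom C h = Cod C (i \<cdot> e) \<and> Cod C h = Cod C g \<and> h \<cdot> (i \<cdot> e) = g"
      using h j(1-4) i(2) E by (intro exI[of _ "h \<cdot> j"]) simp
  next
    fix u v assume uv: "u \<in> Arr C" "v \<in> Arr C" "Dom C u = Cod C (i \<cdot> e)"
      "Dom C v = Cod C (i \<cdot> e)" "Cod C u = Cod C v" "Cod C v \<in> S" "u \<cdot> (i \<cdot> e) = v \<cdot> (i \<cdot> e)"
    have t: "Dom C u = Cod C i" "Dom C v = Cod C i" using uv(3,4) j(1) i(2) E by simp_all
    have "u \<cdot> i = v \<cdot> i"
      using uv(1,2,5-7) t j(1) i(2) E by - (rule universal_arrow_cancel[OF e], auto simp: assoc)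
    then have "(u \<cdot> i) \<cdot> j = (v \<cdot> i) \<cdot> j" by simp
    then show "u = v" using uv(1,2,5) t j by (simp add: assoc)
  qed (use E i j in auto)
qed

lemma universal_arrow_dom_iso:
  assumes e: "universal_arrow C S e" and "Dom C e \<in> S"
  shows "is_iso C e"
proof -
  note E = universal_arrowD[OF e]
  obtain h where h: "h \<in> Arr C" "Dom C h = Cod C e" "Cod C h = Dom C e" "h \<cdot> e = idt C (Dom C e)"
    using universal_arrow_factor[OF e, of "idt C (Dom C e)"] E assms(2) by auto
  have "(e \<cdot> h) \<cdot> e = idt C (Cod C e) \<cdot> e" using h E assoc[of e h e] by simp
  then have "e \<cdot> h = idt C (Cod C e)"
    using h E by - (rule universal_arrow_cancel[OF e], auto)
  then show ?thesis using h E by (intro is_isoI[of e h]) auto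
qed

section \<open>Reflector functors and their unit components\<close>

lemma reflectorD:
  assumes "reflector C S Fo Fm \<eta>"
  shows "\<And>A. A \<in> Obj C \<Longrightarrow> Fo A \<in> S \<and> \<eta> A \<in> Arr C \<and> Dom C (\<eta> A) = A \<and> Cod C (\<eta> A) = Fo A"
    and "\<And>f. f \<in> Arr C \<Longrightarrow> Fm f \<in> Arr C \<and> Dom C (Fm f) = Fo (Dom C f) \<and>
      Cod C (Fm f) = Fo (Cod C f) \<and> \<eta> (Cod C f) \<cdot> f = Fm f \<cdot> \<eta> (Dom C f)"
proof -
  have *: "functor_into C S Fo Fm \<and> (\<forall>A \<in> Obj C. \<eta> A \<in> Hom C A (Fo A)) \<and>
      (\<forall>f \<in> Arr C. \<eta> (Cod C f) \<cdot> f = Fm f \<cdot> \<eta> (Dom C f))"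
    using assms unfolding reflector_def by (elim conjE) (intro conjI)
  then have **: "(\<forall>A \<in> Obj C. Fo A \<in> S) \<and>
     (\<forall>f \<in> Arr C. Fm f \<in> Hom C (Fo (Dom C f)) (Fo (Cod C f)))"
    unfolding functor_into_def by (elim conjE) (intro conjI)
  show "A \<in> Obj C \<Longrightarrow> Fo A \<in> S \<and> \<eta> A \<in> Arr C \<and> Dom C (\<eta> A) = A \<and> Cod C (\<eta> A) = Fo A" for A
    using * ** by simp
  show "f \<in> Arr C \<Longrightarrow> Fm f \<in> Arr C \<and> Dom C (Fm f) = Fo (Dom C f) \<and>
      Cod C (Fm f) = Fo (Cod C f) \<and> \<eta> (Cod C f) \<cdot> f = Fm f \<cdot> \<eta> (Dom C f)" for f
    using * ** by simp
qed

lemma reflector_universal_arrow: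
  assumes r: "reflector C S Fo Fm \<eta>" and A: "A \<in> Obj C"
  shows "universal_arrow C S (\<eta> A)"
proof -
  have "\<forall>A \<in> Obj C. \<forall>B \<in> S. \<forall>g \<in> Hom C A B. \<exists>!h. h \<in> Hom C (Fo A) B \<and> h \<cdot> \<eta> A = g"
    using r unfolding reflector_def by (elim conjE)
  then have "\<forall>B \<in> S. \<forall>g \<in> Hom C A B. \<exists>!h. h \<in> Hom C (Fo A) B \<and> h \<cdot> \<eta> A = g" using A by blast
  then show ?thesis using reflectorD(1)[OF r A] unfolding universal_arrow_def
    by (metis in_Hom)
qed

text \<open>Naturality forces the arrow part, so its values can be chosen one arrow at a time; the
  functor laws then follow by cancelling universal arrows.\<close>

lemma universal_arrows_reflector:
  assumes u: "\<And>A. A \<in> Obj C \<Longrightarrow> universal_arrow C S (\<eta> A) \<and> Dom C (\<eta> A) = A" and S: "S \<subseteq> Obj C"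
  shows "\<exists>Fm. reflector C S (\<lambda>A. Cod C (\<eta> A)) Fm \<eta>"
proof -
  have uA: "universal_arrow C S (\<eta> A)" "Dom C (\<eta> A) = A" "\<eta> A \<in> Arr C" "Cod C (\<eta> A) \<in> S"
    "Cod C (\<eta> A) \<in> Obj C" if "A \<in> Obj C" for A
    using u[OF that] universal_arrowD[of S "\<eta> A"] S by auto
  have "\<exists>h. h \<in> Arr C \<and> Dom C h = Cod C (\<eta> (Dom C f)) \<and> Cod C h = Cod C (\<eta> (Cod C f)) \<and>
      h \<cdot> \<eta> (Dom C f) = \<eta> (Cod C f) \<cdot> f" if f: "f \<in> Arr C" for f
    using universal_arrow_factor[OF uA(1)[of "Dom C f"], of "\<eta> (Cod C f) \<cdot> f"]
      f uA(2-4)[of "Dom C f"] uA(2-4)[of "Cod C f"] by (metis comp_simps dom_cod_Obj)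
  then obtain Fm where Fm: "\<And>f. f \<in> Arr C \<Longrightarrow> Fm f \<in> Arr C \<and>
      Dom C (Fm f) = Cod C (\<eta> (Dom C f)) \<and> Cod C (Fm f) = Cod C (\<eta> (Cod C f)) \<and>
      Fm f \<cdot> \<eta> (Dom C f) = \<eta> (Cod C f) \<cdot> f"
    by metis
  have id: "Fm (idt C A) = idt C (Cod C (\<eta> A))" if A: "A \<in> Obj C" for A
    using Fm[of "idt C A"] A uA[OF A] by - (rule universal_arrow_cancel[OF uA(1)[OF A]], auto)
  have comp: "Fm (g \<cdot> f) = Fm g \<cdot> Fm f" if fg: "f \<in> Arr C" "g \<in> Arr C" "Cod C f = Dom C g" for f g
  proof -
    have d: "Dom C f \<in> Obj C" "Dom C g \<in> Obj C" "Cod C g \<in> Obj C" using fg by auto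
    note t = Fm[OF fg(1)] Fm[OF fg(2)] fg uA(2-4)[OF d(1)] uA(2-4)[OF d(2)] uA(2-4)[OF d(3)]
    have "(Fm g \<cdot> Fm f) \<cdot> \<eta> (Dom C f) = Fm g \<cdot> (Fm f \<cdot> \<eta> (Dom C f))"
      using t by (intro assoc) auto
    also have "\<dots> = Fm g \<cdot> (\<eta> (Dom C g) \<cdot> f)" using t by simp
    also have "\<dots> = (Fm g \<cdot> \<eta> (Dom C g)) \<cdot> f" using t by (intro assoc[symmetric]) auto
    also have "\<dots> = \<eta> (Cod C g) \<cdot> (g \<cdot> f)" using t assoc[of f g "\<eta> (Cod C g)"] by simp
    also have "\<dots> = Fm (g \<cdot> f) \<cdot> \<eta> (Dom C f)" using Fm[of "g \<cdot> f"] fg by simp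
    finally show ?thesis
      using t Fm[of "g \<cdot> f"] by - (rule universal_arrow_cancel[OF uA(1)[OF d(1)]], auto)
  qed
  have ex1: "\<exists>!h. h \<in> Hom C (Cod C (\<eta> A)) B \<and> h \<cdot> \<eta> A = g"
    if "A \<in> Obj C" "B \<in> S" "g \<in> Hom C A B" for A B g
    using universal_arrow_ex1[OF uA(1), of A g] uA(2) that by simp
  have "reflector C S (\<lambda>A. Cod C (\<eta> A)) Fm \<eta>"
    unfolding reflector_def functor_into_def
    by (intro conjI ballI impI ex1) (use id comp Fm uA in auto)
  then show ?thesis by blast
qed

text \<open>The unit at \<open>Cod C q\<close> is invertible because that object lies in
  \<open>S\<close>. By naturality \<open>Fm q\<close> is then, up to this isomorphism, the
  comparison from the reflection of \<open>Dom C q\<close> to \<open>q\<close>.\<close>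

lemma reflector_iso_iff:
  assumes r: "reflector C S Fo Fm \<eta>" and q: "q \<in> Arr C" "Cod C q \<in> S"
  shows "is_iso C (Fm q) \<longleftrightarrow> universal_arrow C S q"
proof -
  have d: "Dom C q \<in> Obj C" "Cod C q \<in> Obj C" using q by auto
  note R = reflectorD(1)[OF r d(1)] reflectorD(1)[OF r d(2)] reflectorD(2)[OF r q(1)]
  note u = reflector_universal_arrow[OF r d(1)] reflector_universal_arrow[OF r d(2)]
  have i: "is_iso C (\<eta> (Cod C q))" using u(2) R q(2) by (intro universal_arrow_dom_iso) auto
  obtain j where j: "j \<in> Arr C" "Dom C j = Fo (Cod C q)" "Cod C j = Cod C q"
    "j \<cdot> \<eta> (Cod C q) = idt C (Cod C q)" "is_iso C j"
    using i R by (metis is_isoE)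
  show ?thesis
  proof
    assume "is_iso C (Fm q)"
    then have "universal_arrow C S ((j \<cdot> Fm q) \<cdot> \<eta> (Dom C q))"
      using R j q by (intro universal_arrow_iso_comp u(1) comp_iso) auto
    moreover have "(j \<cdot> Fm q) \<cdot> \<eta> (Dom C q) = j \<cdot> (Fm q \<cdot> \<eta> (Dom C q))"
      using R j(1-3) by (intro assoc) auto
    moreover have "\<dots> = j \<cdot> (\<eta> (Cod C q) \<cdot> q)" using R by simp
    moreover have "\<dots> = (j \<cdot> \<eta> (Cod C q)) \<cdot> q" using R j(1-3) q by (intro assoc[symmetric]) auto
    ultimately show "universal_arrow C S q" using j(4) q by simp
  next
    assume "universal_arrow C S q"
    then have "universal_arrow C S (\<eta> (Cod C q) \<cdot> q)"
      using i R by (intro universal_arrow_iso_comp) auto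
    then show "is_iso C (Fm q)"
      using R by - (rule universal_arrow_comparison_iso[OF u(1)], auto)
  qed
qed

text \<open>Removes the chosen reflector from semi-left exactness. The comparison \<open>i\<close>
  between an arbitrary universal arrow and the unit component is absorbed into both sides of the
  cospan.\<close>

lemma semi_left_exact_iff:
  assumes r: "reflector C S Fo Fm \<eta>"
  shows "semi_left_exact C S Fo Fm \<eta> \<longleftrightarrow>
    (\<forall>e f p q. universal_arrow C S e \<longrightarrow> is_pullback C e f p q \<longrightarrow> Dom C f \<in> S \<longrightarrow>
       universal_arrow C S q)"
    (is "?L \<longleftrightarrow> ?R")
proof
  assume L: ?L
  show ?R
  proof (intro allI impI)
    fix e f p q assume e: "universal_arrow C S e" and pb: "is_pullback C e f p q"
      and f: "Dom C f \<in> S"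
    note D = pullbackD[OF pb]
    have X: "Dom C e \<in> Obj C" using D(1) by simp
    note R = reflectorD(1)[OF r X]
    obtain i where i: "i \<in> Arr C" "Dom C i = Cod C e" "Cod C i = Fo (Dom C e)" "i \<cdot> e = \<eta> (Dom C e)"
      using universal_arrow_factor[OF e, of "\<eta> (Dom C e)"] R by auto
    have "is_iso C i"
      using universal_arrow_comparison_iso[OF e reflector_universal_arrow[OF r X]] i R by simp
    then have "is_pullback C (i \<cdot> e) (i \<cdot> f) p q \<longleftrightarrow> is_pullback C e f p q"
      using D(1,2,5) i(2) by (intro pullback_comp_monic_iff iso_monic) auto
    then have "is_pullback C (\<eta> (Dom C e)) (i \<cdot> f) p q" using pb i(4) by simp
    moreover have "i \<cdot> f \<in> Hom C (Dom C f) (Fo (Dom C e))" using D(2,5) i(1-3) by simp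
    ultimately have "is_iso C (Fm q)"
      using L X f unfolding semi_left_exact_def by blast
    then show "universal_arrow C S q" using reflector_iso_iff[OF r, of q] D(4,8) f by simp
  qed
next
  assume ?R
  then show ?L unfolding semi_left_exact_def
    using reflector_universal_arrow[OF r] reflector_iso_iff[OF r] pullbackD
    by (metis in_Hom)
qed

end

section \<open>Torsion theories\<close>

definition torsion_part :: "('o, 'm, 'x) cat_scheme \<Rightarrow> 'o set \<Rightarrow> 'o set \<Rightarrow> 'o set" where
  "torsion_part C Z F =
     {A \<in> Obj C. \<forall>g \<in> Arr C. Dom C g = A \<longrightarrow> Cod C g \<in> F \<longrightarrow> g \<in> null_arrows C Z}"

context regular_category_with_zeros
begin

lemma torsion_sequenceD:
  assumes "torsion_sequence C Z T F A t e"
  shows "Z_kernel C Z e t" "Z_cokernel C Z t e" "t \<in> Arr C" "e \<in> Arr C" "Dom C t \<in> T"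
    "Cod C t = A" "Dom C e = A" "Cod C e \<in> F"
  using assms unfolding torsion_sequence_def short_Z_exact_def
  by (auto dest: Z_kernelD Z_cokernelD)

lemma torsion_theoryD:
  assumes "torsion_theory C Z T F"
  shows "full_replete C T" "full_replete C F" "T \<inter> F = Z"
    and "\<And>g. g \<in> Arr C \<Longrightarrow> Dom C g \<in> T \<Longrightarrow> Cod C g \<in> F \<Longrightarrow> null g"
    and "\<And>A. A \<in> Obj C \<Longrightarrow> \<exists>t e. torsion_sequence C Z T F A t e"
proof -
  have *: "full_replete C T \<and> full_replete C F \<and> T \<inter> F = Z \<and>
      (\<forall>A \<in> T. \<forall>B \<in> F. Hom C A B \<subseteq> null_arrows C Z) \<and>
      (\<forall>A \<in> Obj C. \<exists>t e. torsion_sequence C Z T F A t e)"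
    using assms unfolding torsion_theory_def .
  then show "full_replete C T" "full_replete C F" "T \<inter> F = Z"
    "\<And>A. A \<in> Obj C \<Longrightarrow> \<exists>t e. torsion_sequence C Z T F A t e"
    by blast+
  show "null g" if "g \<in> Arr C" "Dom C g \<in> T" "Cod C g \<in> F" for g
  proof -
    have "g \<in> Hom C (Dom C g) (Cod C g)" using that by simp
    then show ?thesis using * that(2,3) by blast
  qed
qed

text \<open>Any \<open>g\<close> into \<open>F\<close> has \<open>g \<cdot> t\<close> null, since
  this composite runs from \<open>T\<close> to \<open>F\<close>; the cokernel property of
  \<open>e\<close> then gives the unique factorization.\<close>

lemma torsion_sequence_universal_arrow:
  assumes tt: "torsion_theory C Z T F" and ts: "torsion_sequence C Z T F A t e"
  shows "universal_arrow C F e"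
  unfolding universal_arrow_def
proof (intro conjI ballI impI)
  note D = torsion_sequenceD[OF ts]
  fix g assume g: "g \<in> Arr C" "Dom C g = Dom C e" "Cod C g \<in> F"
  have "null (g \<cdot> t)"
    by (rule torsion_theoryD(4)[OF tt]) (use g D(3-7) in auto)
  then show "\<exists>!h. h \<in> Hom C (Cod C e) (Cod C g) \<and> h \<cdot> e = g"
    using g D(6,7) by (intro Z_cokernel_universal[OF D(2)]) auto
qed (use torsion_sequenceD[OF ts] in auto)

text \<open>Here \<open>e\<close> is null, so it factors through the counit of its codomain. The
  coreflection lies in \<open>F\<close>, so the universal property of \<open>e\<close> turns this
  factorization into a section of the monic counit.\<close>

lemma reflection_of_torsion_in_Z:
  assumes tt: "torsion_theory C Z T F" and ts: "torsion_sequence C Z T F A t e" and A: "A \<in> T"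
  shows "Cod C e \<in> Z"
proof -
  note D = torsion_sequenceD[OF ts] and u = torsion_sequence_universal_arrow[OF tt ts]
  have ZF: "Z \<subseteq> F" using torsion_theoryD(3)[OF tt] by blast
  have "null e" by (rule torsion_theoryD(4)[OF tt]) (use D A in auto)
  then obtain x where x: "x \<in> Arr C" "Dom C x = Dom C e" "Cod C x = Zo (Cod C e)"
    "\<epsilon> (Cod C e) \<cdot> x = e"
    by (rule null_factor)
  have zF: "Zo (Cod C e) \<in> F" using D(4) ZF by auto
  obtain c where c: "c \<in> Arr C" "Dom C c = Cod C e" "Cod C c = Zo (Cod C e)" "c \<cdot> e = x"
    using universal_arrow_factor[OF u x(1,2)] zF unfolding x(3) by blast
  have "(\<epsilon> (Cod C e) \<cdot> c) \<cdot> e = \<epsilon> (Cod C e) \<cdot> (c \<cdot> e)"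
    using c(1-3) D(4) by (intro assoc) auto
  also have "\<dots> = idt C (Cod C e) \<cdot> e" using c(4) x(4) D(4) by simp
  finally have "(\<epsilon> (Cod C e) \<cdot> c) \<cdot> e = idt C (Cod C e) \<cdot> e" .
  then have "\<epsilon> (Cod C e) \<cdot> c = idt C (Cod C e)"
    using c(1-3) D(4,8) by - (rule universal_arrow_cancel[OF u], auto)
  then have "is_iso C (\<epsilon> (Cod C e))"
    using c(1-3) D(4) by (intro monic_split_epi_iso[of _ c] eps_monic) auto
  then show ?thesis using full_repleteD[OF Z_full_replete, of "\<epsilon> (Cod C e)"] D(4) by simp
qed

text \<open>Injectivity of the correspondence. If all arrows from \<open>A\<close> to
  \<open>F\<close> are null, then so is \<open>e\<close>; hence the identity of \<open>A\<close>
  factors through the kernel \<open>t\<close>, which becomes invertible, and \<open>T\<close> is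
  replete.\<close>

lemma torsion_theory_torsion_part:
  assumes tt: "torsion_theory C Z T F"
  shows "T = torsion_part C Z F"
proof
  have "T \<subseteq> Obj C" using torsion_theoryD(1)[OF tt] unfolding full_replete_def by blast
  then show "T \<subseteq> torsion_part C Z F"
    using torsion_theoryD(4)[OF tt] unfolding torsion_part_def by blast
next
  show "torsion_part C Z F \<subseteq> T"
  proof
    fix A assume A: "A \<in> torsion_part C Z F"
    then have AO: "A \<in> Obj C" unfolding torsion_part_def by blast
    obtain t e where ts: "torsion_sequence C Z T F A t e" using torsion_theoryD(5)[OF tt AO] by blast
    note D = torsion_sequenceD[OF ts]
    have "null e" using A D(4,7,8) unfolding torsion_part_def by blast
    then have "null (e \<cdot> idt C A)" using D(4,7) by simp
    then obtain u where "u \<in> Arr C" "Dom C u = A" "Cod C u = Dom C t" "t \<cdot> u = idt C A"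
      using Z_kernel_universal[OF D(1), of "idt C A"] AO D(7) by auto
    then have "is_iso C t"
      using D(6) by (intro monic_split_epi_iso[of t u] Z_kernel_monic[OF D(1)]) auto
    then show "A \<in> T" using full_repleteD[OF torsion_theoryD(1)[OF tt], of t] D(5,6) by simp
  qed
qed

lemma universal_arrow_Z_iso:
  assumes tt: "torsion_theory C Z T F" and e: "universal_arrow C F e" and "Dom C e \<in> Z"
  shows "is_iso C e"
  using assms torsion_theoryD(3)[OF tt] by (intro universal_arrow_dom_iso[OF e]) blast

end

section \<open>From torsion theories to semi-left exact reflectors\<close>

locale protomodular_category_with_zeros = regular_category_with_zeros + protomodular_category C
begin

text \<open>The pullback \<open>\<kappa>\<close> of \<open>q\<close> along \<open>\<epsilon>\<close> is also a pullback of the reflection of a torsion object,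
  so by (M') and (S) it is a reflection. Factor \<open>q = w \<cdot> e2\<close> through the reflection of its domain.
  As \<open>\<kappa>\<close> is a reflection, the pullback \<open>h'\<close> of \<open>w\<close> along \<open>\<epsilon>\<close> is invertible, so \<open>w\<close> is monic by
  protomodularity, and invertible since \<open>q\<close> is a regular epimorphism.\<close>

lemma torsion_reflection_stable:
  assumes tt: "torsion_theory C Z T F" and M': "condition_M' C Z Zo T F" and S: "condition_S C Z T F"
    and ts: "torsion_sequence C Z T F X t e" and pb: "is_pullback C e f p q" and f: "Dom C f \<in> F"
  shows "universal_arrow C F q"
proof -
  note D = torsion_sequenceD[OF ts] and P = pullbackD[OF pb]
  have ZF: "Z \<subseteq> F" using torsion_theoryD(3)[OF tt] by blast
  have XO: "X \<in> Obj C" using D(4,7) by auto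
  have fO: "Dom C f \<in> Obj C" "Cod C e \<in> Obj C" using P(2) D(4) by auto
  define B where "B = Dom C f"
  have B: "B \<in> Obj C" "Cod C q = B" "B \<in> F" "Dom C f = B" using fO P f unfolding B_def by auto
  note epsB = eps_simps[OF B(1)] and epsE = eps_simps[OF fO(2)]
  obtain x where pbt: "is_pullback C e (\<epsilon> (Cod C e)) t x" using Z_kernel_pullback[OF D(1)] .
  note PT = pullbackD[OF pbt]
  have x: "x \<in> Arr C" "Dom C x = Dom C t" "Cod C x = Zo (Cod C e)"
    using PT(4,6,8) epsE by auto
  obtain t1 e1 where ts1: "torsion_sequence C Z T F (Dom C t) t1 e1"
    using torsion_theoryD(5)[OF tt] D(3) by (meson dom_cod_Obj(1))
  note D1 = torsion_sequenceD[OF ts1] and u1 = torsion_sequence_universal_arrow[OF tt ts1]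
  have e1Z: "Cod C e1 \<in> Z" by (rule reflection_of_torsion_in_Z[OF tt ts1 D(5)])
  have "iso_objects C (Cod C e1) (Zo (Cod C e))"
    using M' XO ts ts1 unfolding condition_M'_def by blast
  then obtain y where y: "y \<in> Arr C" "Dom C y = Cod C e1" "Cod C y = Zo (Cod C e)" "is_iso C y"
    unfolding iso_objects_def by auto
  obtain y' where y': "y' \<in> Arr C" "Dom C y' = Cod C e1" "Cod C y' = Zo (Cod C e)" "y' \<cdot> e1 = x"
    using universal_arrow_factor[OF u1, of x] x D1(7) ZF epsE(4) by auto
  \<comment> \<open>The isomorphism \<open>y\<close> from (M') is arbitrary, but it is parallel to
    the comparison \<open>y'\<close> between zero objects. So \<open>x\<close> is the reflection
    \<open>e1\<close> followed by an isomorphism.\<close>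
  have "y' = y" using y(1-3) y'(1-3) e1Z epsE(4) by (intro Z_posetal) auto
  then have ye1: "y \<cdot> e1 = x" using y' by simp
  \<comment> \<open>\<open>f \<cdot> \<epsilon> B\<close> starts at a zero object, hence factors
    through the coreflection of \<open>Cod C e\<close>, over which the pullback of \<open>e\<close>
    is the torsion part.\<close>
  obtain z where z: "z \<in> Arr C" "Dom C z = Zo B" "Cod C z = Zo (Cod C e)"
    "\<epsilon> (Cod C e) \<cdot> z = f \<cdot> \<epsilon> B"
    using eps_factor[of "f \<cdot> \<epsilon> B"] P(2,5) B(4) epsB by auto
  obtain yi where yi: "yi \<in> Arr C" "Dom C yi = Zo (Cod C e)" "Cod C yi = Cod C e1"
    "y \<cdot> yi = idt C (Zo (Cod C e))"
    using y by (metis is_isoE)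
  \<comment> \<open>\<open>z\<close> is moved along the inverse of \<open>y\<close> so that it ends
    in \<open>Cod C e1\<close>, as (S) demands.\<close>
  define z1 where "z1 = yi \<cdot> z"
  have z1: "z1 \<in> Arr C" "Dom C z1 = Zo B" "Cod C z1 = Cod C e1" "y \<cdot> z1 = z"
    using z(1-3) yi y(1-3) assoc[of z yi y] unfolding z1_def by simp_all
  obtain k \<kappa> where pbk: "is_pullback C q (\<epsilon> B) k \<kappa>"
    by (rule pullback_along[of q "\<epsilon> B"]) (use P(4) B epsB in auto)
  note K = pullbackD[OF pbk]
  have \<kappa>: "\<kappa> \<in> Arr C" "Cod C \<kappa> = Zo B" using K(4,8) epsB by auto
  have k: "k \<in> Arr C" "Dom C k = Dom C \<kappa>" "Cod C k = Dom C q" using K by auto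
  have outer: "is_pullback C e (\<epsilon> (Cod C e) \<cdot> z) (p \<cdot> k) \<kappa>"
    unfolding z(4) by (rule pullback_paste[OF pb pbk])
  obtain l where l: "l \<in> Arr C" "Dom C l = Dom C \<kappa>" "Cod C l = Dom C x" "t \<cdot> l = p \<cdot> k" "x \<cdot> l = z \<cdot> \<kappa>"
  proof (rule pullback_exists[OF pbt, of "p \<cdot> k" "z \<cdot> \<kappa>"])
    show "e \<cdot> (p \<cdot> k) = \<epsilon> (Cod C e) \<cdot> (z \<cdot> \<kappa>)"
      using pullbackD(9)[OF outer] z(1-3) \<kappa> epsE assoc[of \<kappa> z "\<epsilon> (Cod C e)"] by simp
    show "Dom C (p \<cdot> k) = Dom C (z \<cdot> \<kappa>)" "Cod C (p \<cdot> k) = Dom C e" "p \<cdot> k \<in> Arr C"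
      using P(3,6,7) k z(1,2) \<kappa> by simp_all
    fix u assume "u \<in> Arr C" "Dom C u = Dom C (z \<cdot> \<kappa>)" "Cod C u = Dom C x"
      "t \<cdot> u = p \<cdot> k" "x \<cdot> u = z \<cdot> \<kappa>"
    then show thesis using that[of u] z(1,2) \<kappa> by simp
  qed (use z(1-3) \<kappa> epsE in auto)
  \<comment> \<open>Pasting made \<open>\<kappa>\<close> a pullback of \<open>e\<close> along
    \<open>\<epsilon> (Cod C e) \<cdot> z\<close>; cancelling the kernel square leaves a pullback of
    \<open>x\<close> along \<open>z\<close>.\<close>
  have "is_pullback C x z l \<kappa>"
    by (rule pullback_cancel[OF pbt]) (use outer l z(1-3) epsE in auto)
  then have "is_pullback C (y \<cdot> e1) (y \<cdot> z1) l \<kappa>" unfolding ye1 z1(4) .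
  moreover have "is_pullback C (y \<cdot> e1) (y \<cdot> z1) l \<kappa> \<longleftrightarrow> is_pullback C e1 z1 l \<kappa>"
    using y z1 D1(4) by (intro pullback_comp_monic_iff iso_monic) auto
  ultimately have pb1: "is_pullback C e1 z1 l \<kappa>" by blast
  have "z1 \<in> Hom C (Zo B) (Cod C e1)" using z1 by simp
  then have S1: "Dom C \<kappa> \<in> T \<and> (\<forall>t' e'. torsion_sequence C Z T F (Dom C \<kappa>) t' e' \<longrightarrow>
      (\<exists>i \<in> Hom C (Cod C e') (Zo B). is_iso C i \<and> \<kappa> = i \<cdot> e'))"
    using S D(5) ts1 epsB(4) pb1 unfolding condition_S_def by blast
  obtain t3 e3 where ts3: "torsion_sequence C Z T F (Dom C \<kappa>) t3 e3"
    using torsion_theoryD(5)[OF tt] \<kappa>(1) by (meson dom_cod_Obj(1))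
  then obtain i where i: "i \<in> Hom C (Cod C e3) (Zo B)" "is_iso C i" "\<kappa> = i \<cdot> e3" using S1 by blast
  have u\<kappa>: "universal_arrow C F \<kappa>"
    unfolding i(3) using i(1,2) epsB(4) ZF
    by (intro universal_arrow_iso_comp torsion_sequence_universal_arrow[OF tt ts3]) auto
  obtain t2 e2 where ts2: "torsion_sequence C Z T F (Dom C q) t2 e2"
    using torsion_theoryD(5)[OF tt] P(4) by (meson dom_cod_Obj(1))
  note D2 = torsion_sequenceD[OF ts2] and u2 = torsion_sequence_universal_arrow[OF tt ts2]
  obtain w where w: "w \<in> Arr C" "Dom C w = Cod C e2" "Cod C w = B" "w \<cdot> e2 = q"
    using universal_arrow_factor[OF u2, of q] P(4) D2(7) B by auto
  obtain g' h' where pbw: "is_pullback C w (\<epsilon> B) g' h'"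
    by (rule pullback_along[of w "\<epsilon> B"]) (use w epsB in auto)
  note W = pullbackD[OF pbw]
  have h': "h' \<in> Arr C" "Cod C h' = Zo B" using W(4,8) epsB by auto
  have g': "g' \<in> Arr C" "Dom C g' = Dom C h'" "Cod C g' = Cod C e2" using W w by auto
  have wek: "w \<cdot> (e2 \<cdot> k) = \<epsilon> B \<cdot> \<kappa>" "e2 \<cdot> k \<in> Arr C" "Dom C (e2 \<cdot> k) = Dom C \<kappa>"
    "Cod C (e2 \<cdot> k) = Cod C e2"
    using w k D2(4,7) K(9) assoc[of k e2 w] by simp_all
  obtain r where r: "r \<in> Arr C" "Dom C r = Dom C \<kappa>" "Cod C r = Dom C h'"
    "g' \<cdot> r = e2 \<cdot> k" "h' \<cdot> r = \<kappa>"
    by (rule pullback_exists[OF pbw, of "e2 \<cdot> k" \<kappa>]) (use wek w(2) \<kappa> epsB in auto)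
  \<comment> \<open>This square makes \<open>r\<close> a pullback of the cokernel \<open>e2\<close>,
    hence a regular epimorphism, which can be cancelled.\<close>
  have "is_pullback C g' e2 r k"
  proof (rule pullback_cancel[OF pullback_sym[OF pbw]])
    show "is_pullback C (\<epsilon> B) (w \<cdot> e2) (h' \<cdot> r) k"
      unfolding w(4) r(5) by (rule pullback_sym[OF pbk])
  qed (use D2 w r k g' in auto)
  then have rr: "regular_epi C r"
    using regular_epi_stable[OF pullback_sym Z_cokernel_regular_epi[OF D2(2)]] by blast
  \<comment> \<open>The universal property of \<open>\<kappa>\<close> extends
    \<open>e2 \<cdot> k\<close> to \<open>v\<close>. This lifts \<open>\<epsilon> B\<close> along
    \<open>w\<close> and so yields a section \<open>s\<close> of \<open>h'\<close>.\<close>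
  obtain v where v: "v \<in> Arr C" "Dom C v = Zo B" "Cod C v = Cod C e2" "v \<cdot> \<kappa> = e2 \<cdot> k"
    using universal_arrow_factor[OF u\<kappa>, of "e2 \<cdot> k"] wek(2-4) D2(8) \<kappa> by auto
  have "(w \<cdot> v) \<cdot> \<kappa> = \<epsilon> B \<cdot> \<kappa>" using v w(1-3) \<kappa> wek(1) by (simp add: assoc)
  then have wv: "w \<cdot> v = \<epsilon> B"
    using v(1-3) w(1-3) \<kappa> epsB B by - (rule universal_arrow_cancel[OF u\<kappa>], auto)
  obtain s where s: "s \<in> Arr C" "Dom C s = Zo B" "Cod C s = Dom C h'" "g' \<cdot> s = v"
    "h' \<cdot> s = idt C (Zo B)"
    using pullback_exists[OF pbw, of v "idt C (Zo B)"] v w(2) wv epsB by auto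
  have "s \<cdot> \<kappa> = r"
  proof (rule pullback_unique[OF pbw])
    show "g' \<cdot> (s \<cdot> \<kappa>) = g' \<cdot> r"
      using s(1-4) g' \<kappa> v(4) r(4) assoc[of \<kappa> s g'] by simp
    show "h' \<cdot> (s \<cdot> \<kappa>) = h' \<cdot> r"
      using s(1-3,5) h' \<kappa> r(5) assoc[of \<kappa> s h'] by simp
  qed (use s(1-3) \<kappa> r in auto)
  \<comment> \<open>The section is two-sided because
    \<open>s \<cdot> (h' \<cdot> r) = s \<cdot> \<kappa> = r\<close> and \<open>r\<close>
    cancels.\<close>
  then have "(s \<cdot> h') \<cdot> r = idt C (Dom C h') \<cdot> r"
    using s(1-3) h' r assoc[of r h' s] by simp
  then have "s \<cdot> h' = idt C (Dom C h')"
    using s(1-3) h' r(1-3) by - (rule regular_epi_cancel[OF rr], auto)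
  then have "is_iso C h'" using s h' by (intro is_isoI[of h' s]) auto
  then have wm: "monic C w"
    using pullback_reflects_monic[OF regular_category_axioms protomodular_category_axioms pbw]
    by (simp add: iso_monic)
  have "regular_epi C q" by (rule regular_epi_stable[OF pb Z_cokernel_regular_epi[OF D(2)]])
  then have "is_iso C w"
    using D2(4) w by (intro regular_epi_through_monic_iso[of q w e2] wm) auto
  then have "universal_arrow C F (w \<cdot> e2)"
    using w B by (intro universal_arrow_iso_comp u2) auto
  then show ?thesis unfolding w(4) .
qed

lemma torsion_theory_reflector:
  assumes tt: "torsion_theory C Z T F" and M': "condition_M' C Z Zo T F" and S: "condition_S C Z T F"
  shows "\<exists>Fo Fm \<eta>. reflector C F Fo Fm \<eta> \<and> (\<forall>A \<in> Obj C. is_Z_cokernel C Z (\<eta> A)) \<and>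
    (\<forall>W \<in> Z. is_iso C (\<eta> W)) \<and> semi_left_exact C F Fo Fm \<eta>"
proof -
  obtain t \<eta> where ts: "\<And>A. A \<in> Obj C \<Longrightarrow> torsion_sequence C Z T F A (t A) (\<eta> A)"
    using torsion_theoryD(5)[OF tt] by metis
  have u: "universal_arrow C F (\<eta> A) \<and> Dom C (\<eta> A) = A" if "A \<in> Obj C" for A
    using torsion_sequence_universal_arrow[OF tt ts[OF that]] torsion_sequenceD[OF ts[OF that]] by simp
  have "F \<subseteq> Obj C" using torsion_theoryD(2)[OF tt] unfolding full_replete_def by blast
  then obtain Fm where r: "reflector C F (\<lambda>A. Cod C (\<eta> A)) Fm \<eta>"
    using universal_arrows_reflector[of F \<eta>] u by blast
  moreover have "is_Z_cokernel C Z (\<eta> A)" if "A \<in> Obj C" for A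
    using torsion_sequenceD(2)[OF ts[OF that]] unfolding is_Z_cokernel_def by blast
  moreover have "is_iso C (\<eta> W)" if "W \<in> Z" for W
    using universal_arrow_Z_iso[OF tt, of "\<eta> W"] u[OF Z_Obj[OF that]] that by simp
  moreover have "semi_left_exact C F (\<lambda>A. Cod C (\<eta> A)) Fm \<eta>"
    unfolding semi_left_exact_def
  proof (intro ballI allI impI)
    fix X A f p q assume X: "X \<in> Obj C" and f: "A \<in> F" "f \<in> Hom C A (Cod C (\<eta> X))"
      and pb: "is_pullback C (\<eta> X) f p q"
    have "universal_arrow C F q"
      using f by (intro torsion_reflection_stable[OF tt M' S ts[OF X] pb]) auto
    then show "is_iso C (Fm q)"
      using reflector_iso_iff[OF r] universal_arrowD by blast
  qed
  ultimately show ?thesis by blast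
qed

end

section \<open>From semi-left exact reflectors to torsion theories\<close>

context regular_category_with_zeros
begin

context
  fixes F :: "'o set"
  assumes F: "full_replete C F" and ZF: "Z \<subseteq> F"
    and reflections: "\<And>A. A \<in> Obj C \<Longrightarrow> \<exists>e. universal_arrow C F e \<and> Dom C e = A \<and> is_Z_cokernel C Z e"
    and stable: "\<And>e f p q. universal_arrow C F e \<Longrightarrow> is_pullback C e f p q \<Longrightarrow> Dom C f \<in> F \<Longrightarrow>
      universal_arrow C F q"
begin

text \<open>Every arrow from \<open>Dom C x\<close> into \<open>F\<close> factors through
  \<open>x\<close>, hence through a zero object.\<close>

lemma dom_universal_arrow_torsion:
  assumes x: "universal_arrow C F x" and "Cod C x \<in> Z"
  shows "Dom C x \<in> torsion_part C Z F"
  unfolding torsion_part_def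
proof (intro CollectI conjI ballI impI)
  note X = universal_arrowD[OF x]
  show "Dom C x \<in> Obj C" using X by simp
  fix g assume "g \<in> Arr C" "Dom C g = Dom C x" "Cod C g \<in> F"
  then obtain h where "h \<in> Arr C" "Dom C h = Cod C x" "h \<cdot> x = g"
    using universal_arrow_factor[OF x, of g] by auto
  then show "null g" using X assms(2) by (intro null_arrowsI[of x h]) auto
qed

lemma torsion_part_replete: "full_replete C (torsion_part C Z F)"
  unfolding full_replete_def
proof (intro conjI ballI impI)
  show "torsion_part C Z F \<subseteq> Obj C" unfolding torsion_part_def by blast
  fix A B assume A: "A \<in> torsion_part C Z F" and B: "B \<in> Obj C" and "iso_objects C A B"
  then obtain i where "is_iso C i" "Dom C i = A" "Cod C i = B"
    unfolding iso_objects_def by auto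
  then obtain j where i: "i \<in> Arr C" "Dom C i = A" "Cod C i = B" "j \<in> Arr C" "Dom C j = B"
    "Cod C j = A" "i \<cdot> j = idt C B"
    by (metis is_isoE)
  show "B \<in> torsion_part C Z F"
    unfolding torsion_part_def
  proof (intro CollectI conjI ballI impI B)
    fix g assume g: "g \<in> Arr C" "Dom C g = B" "Cod C g \<in> F"
    have "g \<cdot> i \<in> Arr C" "Dom C (g \<cdot> i) = A" "Cod C (g \<cdot> i) \<in> F" using g i by simp_all
    then have "null (g \<cdot> i)" using A unfolding torsion_part_def by blast
    then have "null ((g \<cdot> i) \<cdot> j)" using g i by - (rule null_comp_right, auto)
    moreover have "(g \<cdot> i) \<cdot> j = g" using g i by (simp add: assoc)
    ultimately show "null g" by simp
  qed
qed

lemma reflection_torsion_theory: "torsion_theory C Z (torsion_part C Z F) F"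
  unfolding torsion_theory_def
proof (intro conjI ballI)
  have FO: "F \<subseteq> Obj C" using F unfolding full_replete_def by blast
  show "torsion_part C Z F \<inter> F = Z"
  proof
    show "torsion_part C Z F \<inter> F \<subseteq> Z"
    proof
      fix A assume A: "A \<in> torsion_part C Z F \<inter> F"
      then have AO: "A \<in> Obj C" using FO by blast
      have "idt C A \<in> Arr C" "Dom C (idt C A) = A" "Cod C (idt C A) \<in> F" using AO A by simp_all
      then have "null (idt C A)" using A unfolding torsion_part_def by blast
      then show "A \<in> Z" using AO by (rule null_idt_in_Z)
    qed
    show "Z \<subseteq> torsion_part C Z F \<inter> F"
      using ZF Z_Obj null_dom unfolding torsion_part_def by blast
  qed
next
  fix A B assume "A \<in> torsion_part C Z F" "B \<in> F"
  then show "Hom C A B \<subseteq> null_arrows C Z" unfolding torsion_part_def by auto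
next
  fix A assume A: "A \<in> Obj C"
  obtain e where e: "universal_arrow C F e" "Dom C e = A" "is_Z_cokernel C Z e"
    using reflections[OF A] by blast
  note E = universal_arrowD[OF e(1)]
  obtain t x where pb: "is_pullback C e (\<epsilon> (Cod C e)) t x"
    by (rule pullback_along[of e "\<epsilon> (Cod C e)"]) (use E in auto)
  note P = pullbackD[OF pb]
  have k: "Z_kernel C Z e t" by (rule pullback_Z_kernel[OF pb])
  have zc: "Zo (Cod C e) \<in> Z" "Dom C (\<epsilon> (Cod C e)) = Zo (Cod C e)" using E by simp_all
  \<comment> \<open>The counit starts at a zero object, which lies in \<open>F\<close>, so stability
    applies to the kernel square: the leg opposite \<open>e\<close> is a reflection with zero
    codomain.\<close>
  have x: "universal_arrow C F x" using stable[OF e(1) pb] zc ZF by auto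
  have T: "Dom C t \<in> torsion_part C Z F"
    using dom_universal_arrow_torsion[OF x] P(6,8) zc by simp
  \<comment> \<open>\<open>e\<close> is a cokernel of some \<open>c\<close>, and \<open>c\<close>
    factors through the kernel \<open>t\<close>. Whatever makes \<open>t\<close> null therefore
    makes \<open>c\<close> null and factors through \<open>e\<close>.\<close>
  have "Z_cokernel C Z t e"
  proof -
    obtain c where c: "Z_cokernel C Z c e" using e(3) unfolding is_Z_cokernel_def by blast
    note K = Z_cokernelD[OF c]
    obtain u where u: "u \<in> Arr C" "Dom C u = Dom C c" "Cod C u = Dom C t" "t \<cdot> u = c"
      using Z_kernel_universal[OF k, of c] K by auto
    have "\<exists>!h. h \<in> Hom C (Cod C e) (Cod C g) \<and> h \<cdot> e = g"
      if g: "g \<in> Arr C" "Dom C g = Cod C t" "null (g \<cdot> t)" for g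
    proof (rule Z_cokernel_universal[OF c])
      have "null ((g \<cdot> t) \<cdot> u)" using g u(1-3) P(3) by - (rule null_comp_right, auto)
      then show "null (g \<cdot> c)" using g u P(3) by (simp add: assoc)
    qed (use g K P(7) in auto)
    then show ?thesis
      using P(3,7) E Z_kernelD(4)[OF k] unfolding Z_cokernel_def by auto
  qed
  then have "torsion_sequence C Z (torsion_part C Z F) F A t e"
    using k T P(7) e(2) E unfolding torsion_sequence_def short_Z_exact_def by auto
  then show "\<exists>t e. torsion_sequence C Z (torsion_part C Z F) F A t e" by blast
qed (use F torsion_part_replete in auto)

text \<open>By stability the leg \<open>x\<close> of the kernel square is a reflection of the
  torsion part whose codomain is the required coreflection; any other reflection \<open>e'\<close>
  is isomorphic to it.\<close>

lemma reflection_condition_M': "condition_M' C Z Zo (torsion_part C Z F) F"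
  unfolding condition_M'_def
proof (intro ballI allI impI)
  note tt = reflection_torsion_theory
  fix A t e t' e'
  assume ts: "torsion_sequence C Z (torsion_part C Z F) F A t e"
    and ts': "torsion_sequence C Z (torsion_part C Z F) F (Dom C t) t' e'"
  note D = torsion_sequenceD[OF ts] and D' = torsion_sequenceD[OF ts']
  note u = torsion_sequence_universal_arrow[OF tt ts] torsion_sequence_universal_arrow[OF tt ts']
  obtain x where pb: "is_pullback C e (\<epsilon> (Cod C e)) t x" using Z_kernel_pullback[OF D(1)] .
  note P = pullbackD[OF pb]
  have zc: "Zo (Cod C e) \<in> Z" "Dom C (\<epsilon> (Cod C e)) = Zo (Cod C e)" using D(4) by simp_all
  have x: "universal_arrow C F x" using stable[OF u(1) pb] zc ZF by auto
  obtain h where h: "h \<in> Arr C" "Dom C h = Cod C e'" "Cod C h = Cod C x" "h \<cdot> e' = x"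
    using universal_arrow_factor[OF u(2), of x] universal_arrowD[OF x] P(6) D'(7) by auto
  have "is_iso C h" by (rule universal_arrow_comparison_iso[OF u(2) x h])
  then show "iso_objects C (Cod C e') (Zo (Cod C e))"
    using h P(8) zc by (intro iso_objectsI) auto
qed

text \<open>Arrows out of zero objects are arrows out of \<open>F\<close>, so \<open>\<chi>\<close>
  is a reflection by stability, and its zero codomain makes its domain torsion.\<close>

lemma reflection_condition_S: "condition_S C Z (torsion_part C Z F) F"
  unfolding condition_S_def
proof (intro ballI allI impI)
  note tt = reflection_torsion_theory
  fix A t e Z' f p \<chi>
  assume ts: "torsion_sequence C Z (torsion_part C Z F) F A t e" and Z': "Z' \<in> Z"
    and f: "f \<in> Hom C Z' (Cod C e)" and pb: "is_pullback C e f p \<chi>"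
  note P = pullbackD[OF pb]
  have u: "universal_arrow C F \<chi>"
    using f Z' ZF by (intro stable[OF torsion_sequence_universal_arrow[OF tt ts] pb]) auto
  have c: "Cod C \<chi> = Z'" using P(8) f by simp
  have "\<exists>i\<in>Hom C (Cod C e') Z'. is_iso C i \<and> \<chi> = i \<cdot> e'"
    if ts': "torsion_sequence C Z (torsion_part C Z F) F (Dom C \<chi>) t' e'" for t' e'
  proof -
    note D' = torsion_sequenceD[OF ts'] and u' = torsion_sequence_universal_arrow[OF tt ts']
    obtain h where h: "h \<in> Arr C" "Dom C h = Cod C e'" "Cod C h = Cod C \<chi>" "h \<cdot> e' = \<chi>"
      using universal_arrow_factor[OF u', of \<chi>] universal_arrowD[OF u] D'(7) by auto
    have "is_iso C h" by (rule universal_arrow_comparison_iso[OF u' u h])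
    then show ?thesis using h c by (intro bexI[of _ h]) auto
  qed
  then show "Dom C \<chi> \<in> torsion_part C Z F \<and> (\<forall>t' e'.
      torsion_sequence C Z (torsion_part C Z F) F (Dom C \<chi>) t' e' \<longrightarrow>
      (\<exists>i\<in>Hom C (Cod C e') Z'. is_iso C i \<and> \<chi> = i \<cdot> e'))"
    using dom_universal_arrow_torsion[OF u] c Z' by blast
qed

end

lemma reflector_torsion_theory:
  assumes F: "full_replete C F" and r: "reflector C F Fo Fm \<eta>"
    and cok: "\<forall>A \<in> Obj C. is_Z_cokernel C Z (\<eta> A)" and iso: "\<forall>W \<in> Z. is_iso C (\<eta> W)"
    and sle: "semi_left_exact C F Fo Fm \<eta>"
  shows "torsion_theory C Z (torsion_part C Z F) F" "condition_M' C Z Zo (torsion_part C Z F) F"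
    "condition_S C Z (torsion_part C Z F) F"
proof -
  \<comment> \<open>\<open>\<eta> W\<close> is an isomorphism from \<open>W\<close> to an object of
    the replete \<open>F\<close>.\<close>
  have ZF: "Z \<subseteq> F"
  proof
    fix W assume W: "W \<in> Z"
    then show "W \<in> F"
      using full_repleteD[OF F, of "\<eta> W"] iso reflectorD(1)[OF r Z_Obj[OF W]] by simp
  qed
  have refl: "\<exists>e. universal_arrow C F e \<and> Dom C e = A \<and> is_Z_cokernel C Z e" if "A \<in> Obj C" for A
    using reflector_universal_arrow[OF r that] reflectorD(1)[OF r that] cok that by blast
  have stable: "universal_arrow C F q"
    if "universal_arrow C F e" "is_pullback C e f p q" "Dom C f \<in> F" for e f p q
    using sle that unfolding semi_left_exact_iff[OF r] by blast
  show "torsion_theory C Z (torsion_part C Z F) F"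
    by (rule reflection_torsion_theory[OF F ZF]) (assumption | rule refl | rule stable)+
  show "condition_M' C Z Zo (torsion_part C Z F) F"
    by (rule reflection_condition_M'[OF F ZF]) (assumption | rule refl | rule stable)+
  show "condition_S C Z (torsion_part C Z F) F"
    by (rule reflection_condition_S[OF F ZF]) (assumption | rule refl | rule stable)+
qed

end

text \<open>A reflector is determined by \<open>F\<close> up to isomorphism, so it enters under an
  existential quantifier and the right-hand side consists of sets of objects alone.\<close>

theorem proposition4p15:
  fixes C :: "('o, 'm) cat"
    and Z :: "'o set" and Zo :: "'o \<Rightarrow> 'o" and Zm :: "'m \<Rightarrow> 'm" and \<epsilon> :: "'o \<Rightarrow> 'm"
  assumes "regular_category C"
    and "protomodular_category C"
    and "class_of_zero_objects C Z Zo Zm \<epsilon>"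
  shows "bij_betw (\<lambda>(T, F). F)
    {(T, F). torsion_theory C Z T F \<and> condition_M' C Z Zo T F \<and> condition_S C Z T F}
    {F. full_replete C F \<and>
        (\<exists>Fo Fm \<eta>. reflector C F Fo Fm \<eta> \<and>
           (\<forall>A \<in> Obj C. is_Z_cokernel C Z (\<eta> A)) \<and>
           (\<forall>W \<in> Z. is_iso C (\<eta> W)) \<and>
           semi_left_exact C F Fo Fm \<eta>)}"
proof -
  interpret regular_category C by fact
  interpret protomodular_category C by fact
  interpret protomodular_category_with_zeros C Z Zo Zm \<epsilon>
    by unfold_locales fact
  let ?A = "{(T, F). torsion_theory C Z T F \<and> condition_M' C Z Zo T F \<and> condition_S C Z T F}"
  let ?B = "{F. full_replete C F \<and>
        (\<exists>Fo Fm \<eta>. reflector C F Fo Fm \<eta> \<and>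
           (\<forall>A \<in> Obj C. is_Z_cokernel C Z (\<eta> A)) \<and>
           (\<forall>W \<in> Z. is_iso C (\<eta> W)) \<and>
           semi_left_exact C F Fo Fm \<eta>)}"
  have into: "F \<in> ?B" if "(T, F) \<in> ?A" for T F
    using that torsion_theory_reflector[of T F] torsion_theoryD(2)[of T F] by simp
  have onto: "(torsion_part C Z F, F) \<in> ?A" if "F \<in> ?B" for F
  proof -
    obtain Fo Fm \<eta> where "full_replete C F" "reflector C F Fo Fm \<eta>"
      "\<forall>A \<in> Obj C. is_Z_cokernel C Z (\<eta> A)" "\<forall>W \<in> Z. is_iso C (\<eta> W)"
      "semi_left_exact C F Fo Fm \<eta>"
      using \<open>F \<in> ?B\<close> by blast
    from reflector_torsion_theory[OF this] show ?thesis by simp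
  qed
  have inj: "T = torsion_part C Z F" if "(T, F) \<in> ?A" for T F
    using that by (intro torsion_theory_torsion_part) simp
  show ?thesis
  \<comment> \<open>The inverse attaches to \<open>F\<close> its torsion part; that it recovers the
    given \<open>T\<close> is the fact \<open>inj\<close>.\<close>
  proof (rule bij_betw_byWitness[where f' = "\<lambda>F. (torsion_part C Z F, F)"])
    show "\<forall>a\<in>?A. (torsion_part C Z (case a of (T, F) \<Rightarrow> F), case a of (T, F) \<Rightarrow> F) = a"
      using inj by (metis (no_types, lifting) case_prod_conv surj_pair)
    show "\<forall>F\<in>?B. (case (torsion_part C Z F, F) of (T, F) \<Rightarrow> F) = F"
      by simp
    show "(\<lambda>(T, F). F) ` ?A \<subseteq> ?B"
    proof (rule image_subsetI)
      fix a assume "a \<in> ?A"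
      then show "(case a of (T, F) \<Rightarrow> F) \<in> ?B"
        using into[of "fst a" "snd a"] by (simp only: prod.collapse case_prod_unfold)
    qed
    show "(\<lambda>F. (torsion_part C Z F, F)) ` ?B \<subseteq> ?A"
      using onto by (auto simp only: image_subset_iff)
  qed
qed

end
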